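(* Every well-typed term of $\lambda^{\Box\rightarrow\wedge\vee}$ is strongly normalizing with respect to the reduction relation given by the union of the detour conversions $>_D$ and the permutation conversions $>_P$.
   Context: $\lambda^{\Box\rightarrow\wedge\vee}$: types $T::=p\mid A\rightarrow B\mid A\times B\mid A+B\mid \Box A$; terms $x\mid \lambda x.t\mid ts\mid \langle t,s\rangle\mid \pi_1 t\mid \pi_2 t\mid \mathsf{in}_1 t\mid \mathsf{in}_2 t\mid \mathsf{C}_{x,y}(t,t_1,t_2)\mid \mathsf{B}_{x_1,\dots,x_n}(t_1,\dots,t_n)\,\mathsf{in}\,s$ ($\mathsf{C}$ binds $x$ in $t_1$, $y$ in $t_2$; $\mathsf{B}$ binds $x_1,\dots,x_n$ in $s$). Typing: standard simply typed rules for $\rightarrow,\times,+$, plus: if $\Gamma_i\vdash t_i:\Box A_i$ and $x_1:A_1,\dots,x_n:A_n,\Delta\vdash s:B$ then $\Gamma_1,\dots,\Gamma_n,\Delta\vdash\mathsf{B}_{x_1,\dots,x_n}(t_1,\dots,t_n)\,\mathsf{in}\,s:\Box B$. (This is the proof-term calculus of the $\bot$-free fragment of the natural deduction system $\mathsf{IEL}^{-}$ for intuitionistic belief.) Reductions are closed under term contexts. Detours $>_D$: $(\lambda x.t)s> t[x:=s]$; $\pi_i\langle t_1,t_2\rangle> t_i$; $\mathsf{C}_{x_1,x_2}(\mathsf{in}_i t,t_1,t_2)> t_i[x_i:=t]$; $\mathsf{B}_{x_1,\dots,x_{i-1},x_i,x_{i+1},\dots,x_n}(t_1,\dots,t_{i-1},(\mathsf{B}_{\vec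 y}(\vec s)\,\mathsf{in}\,t_i),t_{i+1},\dots,t_n)\,\mathsf{in}\,r > \mathsf{B}_{x_1,\dots,x_{i-1},\vec y,x_{i+1},\dots,x_n}(t_1,\dots,t_{i-1},\vec s,t_{i+1},\dots,t_n)\,\mathsf{in}\,r[x_i:=t_i]$; $\mathsf{B}_x t\,\mathsf{in}\,x> t$. Permutations $>_P$: $\mathsf{C}_{x,y}(t,t_1,t_2)s>\mathsf{C}_{x,y}(t,t_1s,t_2s)$; $\pi_i\mathsf{C}_{x,y}(t,t_1,t_2)>\mathsf{C}_{x,y}(t,\pi_it_1,\pi_it_2)$; $\mathsf{C}_{u,v}(\mathsf{C}_{x,y}(t,t_1,t_2),s_1,s_2)>\mathsf{C}_{x,y}(t,\mathsf{C}_{u,v}(t_1,s_1,s_2),\mathsf{C}_{u,v}(t_2,s_1,s_2))$; $\mathsf{B}_{\vec x}(t_1,\dots,t_{i-1},\mathsf{C}_{x,y}(t,s_1,s_2),t_{i+1},\dots,t_n)\,\mathsf{in}\,s>\mathsf{C}_{x,y}(t,\mathsf{B}_{\vec x}(t_1,\dots,t_{i-1},s_1,t_{i+1},\dots,t_n)\,\mathsf{in}\,s,\ \mathsf{B}_{\vec x}(t_1,\dots,t_{i-1},s_2,t_{i+1},\dots,t_n)\,\mathsf{in}\,s)$. *)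

theory Defs
  imports Main
begin

datatype ty = Atom nat | Arrow ty ty | Prod ty ty | Sum ty ty | Box ty

text \<open>
  Terms up to renaming of bound variables, with de Bruijn indices. \<open>Lam t\<close> binds index 0 of \<open>t\<close>;
  \<open>Case t t1 t2\<close> binds index 0 of \<open>t1\<close> and index 0 of \<open>t2\<close>; \<open>Bel [t1, \<dots>, tn] s\<close> stands for
  B_{x1,...,xn}(t1,...,tn) in s and binds the indices \<open>0, \<dots>, n - 1\<close> of \<open>s\<close>, the index \<open>i - 1\<close>
  standing for xi. Here n may be 0, as the introduction of \<open>A \<rightarrow> \<box>A\<close> requires.
\<close>

datatype tm =
    Var nat
  | Lam tm
  | App tm tm
  | Pair tm tm
  | Pr1 tm
  | Pr2 tm
  | In1 tm
  | In2 tm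
  | Case tm tm tm
  | Bel "tm list" tm

text \<open>Renamings and simultaneous substitutions; \<open>up_ren n\<close> and \<open>up_sub n\<close> move them under n binders.\<close>

definition up_ren :: "nat \<Rightarrow> (nat \<Rightarrow> nat) \<Rightarrow> nat \<Rightarrow> nat" where
  "up_ren n \<rho> = (\<lambda>i. if i < n then i else \<rho> (i - n) + n)"

fun ren :: "(nat \<Rightarrow> nat) \<Rightarrow> tm \<Rightarrow> tm" where
  "ren \<rho> (Var i) = Var (\<rho> i)"
| "ren \<rho> (Lam t) = Lam (ren (up_ren 1 \<rho>) t)"
| "ren \<rho> (App t s) = App (ren \<rho> t) (ren \<rho> s)"
| "ren \<rho> (Pair t s) = Pair (ren \<rho> t) (ren \<rho> s)"
| "ren \<rho> (Pr1 t) = Pr1 (ren \<rho> t)"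
| "ren \<rho> (Pr2 t) = Pr2 (ren \<rho> t)"
| "ren \<rho> (In1 t) = In1 (ren \<rho> t)"
| "ren \<rho> (In2 t) = In2 (ren \<rho> t)"
| "ren \<rho> (Case t t1 t2) = Case (ren \<rho> t) (ren (up_ren 1 \<rho>) t1) (ren (up_ren 1 \<rho>) t2)"
| "ren \<rho> (Bel ts s) = Bel (map (ren \<rho>) ts) (ren (up_ren (length ts) \<rho>) s)"

definition up_sub :: "nat \<Rightarrow> (nat \<Rightarrow> tm) \<Rightarrow> nat \<Rightarrow> tm" where
  "up_sub n \<sigma> = (\<lambda>i. if i < n then Var i else ren (\<lambda>k. k + n) (\<sigma> (i - n)))"

fun sub :: "(nat \<Rightarrow> tm) \<Rightarrow> tm \<Rightarrow> tm" where
  "sub \<sigma> (Var i) = \<sigma> i"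
| "sub \<sigma> (Lam t) = Lam (sub (up_sub 1 \<sigma>) t)"
| "sub \<sigma> (App t s) = App (sub \<sigma> t) (sub \<sigma> s)"
| "sub \<sigma> (Pair t s) = Pair (sub \<sigma> t) (sub \<sigma> s)"
| "sub \<sigma> (Pr1 t) = Pr1 (sub \<sigma> t)"
| "sub \<sigma> (Pr2 t) = Pr2 (sub \<sigma> t)"
| "sub \<sigma> (In1 t) = In1 (sub \<sigma> t)"
| "sub \<sigma> (In2 t) = In2 (sub \<sigma> t)"
| "sub \<sigma> (Case t t1 t2) = Case (sub \<sigma> t) (sub (up_sub 1 \<sigma>) t1) (sub (up_sub 1 \<sigma>) t2)"
| "sub \<sigma> (Bel ts s) = Bel (map (sub \<sigma>) ts) (sub (up_sub (length ts) \<sigma>) s)"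

text \<open>\<open>subst0 s t\<close> is t[x := s] for the variable x with index 0, whose binder is removed.\<close>

definition subst0 :: "tm \<Rightarrow> tm \<Rightarrow> tm" where
  "subst0 s t = sub (\<lambda>i. case i of 0 \<Rightarrow> s | Suc k \<Rightarrow> Var k) t"

text \<open>
  \<open>wk n t\<close> is \<open>t\<close> placed under n additional binders; \<open>wk_above k t\<close> is \<open>t\<close>, itself under k binders,
  with one additional binder inserted outside of these k.
\<close>

definition wk :: "nat \<Rightarrow> tm \<Rightarrow> tm" where
  "wk n t = ren (\<lambda>k. k + n) t"

definition wk_above :: "nat \<Rightarrow> tm \<Rightarrow> tm" where
  "wk_above k t = ren (up_ren k Suc) t"

text \<open>
  The body of the contractum of a nested B. Write \<open>us\<close>, \<open>vs\<close> for the arguments of the outer B on the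
  two sides of the inner B, and let p and q be their lengths. The outer body r lives under the binders
  x1,...,xn (n = p + 1 + q) and the inner body t under y1,...,ym; the contractum
  r[x_(p+1) := t] lives under x1,...,xp, y1,...,ym, x_(p+2),...,xn.
\<close>

definition merge_body :: "nat \<Rightarrow> nat \<Rightarrow> nat \<Rightarrow> tm \<Rightarrow> tm \<Rightarrow> tm" where
  "merge_body p m q t r =
     sub (\<lambda>j. if j < p then Var j
              else if j = p then ren (\<lambda>k. if k < m then p + k else p + q + k) t
              else Var (j + m - 1)) r"

text \<open>
  A context lists the types of the indices 0, 1, \<dots>. The premises of each rule share one context,
  the merge of the contexts of the premises; weakening is built into the variable rule.
\<close>

inductive typed :: "ty list \<Rightarrow> tm \<Rightarrow> ty \<Rightarrow> bool" where
  ty_Var: "i < length \<Gamma> \<Longrightarrow> \<Gamma> ! i = A \<Longrightarrow> typed \<Gamma> (Var i) A"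
| ty_Lam: "typed (A # \<Gamma>) t B \<Longrightarrow> typed \<Gamma> (Lam t) (Arrow A B)"
| ty_App: "typed \<Gamma> t (Arrow A B) \<Longrightarrow> typed \<Gamma> s A \<Longrightarrow> typed \<Gamma> (App t s) B"
| ty_Pair: "typed \<Gamma> t A \<Longrightarrow> typed \<Gamma> s B \<Longrightarrow> typed \<Gamma> (Pair t s) (Prod A B)"
| ty_Pr1: "typed \<Gamma> t (Prod A B) \<Longrightarrow> typed \<Gamma> (Pr1 t) A"
| ty_Pr2: "typed \<Gamma> t (Prod A B) \<Longrightarrow> typed \<Gamma> (Pr2 t) B"
| ty_In1: "typed \<Gamma> t A \<Longrightarrow> typed \<Gamma> (In1 t) (Sum A B)"
| ty_In2: "typed \<Gamma> t B \<Longrightarrow> typed \<Gamma> (In2 t) (Sum A B)"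
| ty_Case: "typed \<Gamma> t (Sum A B) \<Longrightarrow> typed (A # \<Gamma>) t1 C \<Longrightarrow> typed (B # \<Gamma>) t2 C
            \<Longrightarrow> typed \<Gamma> (Case t t1 t2) C"
| ty_Bel: "list_all2 (\<lambda>t A. typed \<Gamma> t (Box A)) ts As \<Longrightarrow> typed (As @ \<Gamma>) s B
            \<Longrightarrow> typed \<Gamma> (Bel ts s) (Box B)"

inductive detour_rule :: "tm \<Rightarrow> tm \<Rightarrow> bool" where
  "detour_rule (App (Lam t) s) (subst0 s t)"
| "detour_rule (Pr1 (Pair t1 t2)) t1"
| "detour_rule (Pr2 (Pair t1 t2)) t2"
| "detour_rule (Case (In1 t) t1 t2) (subst0 t t1)"
| "detour_rule (Case (In2 t) t1 t2) (subst0 t t2)"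
| "detour_rule (Bel (us @ Bel ss t # vs) r)
               (Bel (us @ ss @ vs) (merge_body (length us) (length ss) (length vs) t r))"
| "detour_rule (Bel [t] (Var 0)) t"

inductive perm_rule :: "tm \<Rightarrow> tm \<Rightarrow> bool" where
  "perm_rule (App (Case t t1 t2) s) (Case t (App t1 (wk 1 s)) (App t2 (wk 1 s)))"
| "perm_rule (Pr1 (Case t t1 t2)) (Case t (Pr1 t1) (Pr1 t2))"
| "perm_rule (Pr2 (Case t t1 t2)) (Case t (Pr2 t1) (Pr2 t2))"
| "perm_rule (Case (Case t t1 t2) s1 s2)
             (Case t (Case t1 (wk_above 1 s1) (wk_above 1 s2))
                     (Case t2 (wk_above 1 s1) (wk_above 1 s2)))"
| "perm_rule (Bel (us @ Case t s1 s2 # vs) s)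
             (Case t
               (Bel (map (wk 1) us @ s1 # map (wk 1) vs) (wk_above (length us + 1 + length vs) s))
               (Bel (map (wk 1) us @ s2 # map (wk 1) vs) (wk_above (length us + 1 + length vs) s)))"

inductive ctxt_closure :: "(tm \<Rightarrow> tm \<Rightarrow> bool) \<Rightarrow> tm \<Rightarrow> tm \<Rightarrow> bool" for R where
  "R t t' \<Longrightarrow> ctxt_closure R t t'"
| "ctxt_closure R t t' \<Longrightarrow> ctxt_closure R (Lam t) (Lam t')"
| "ctxt_closure R t t' \<Longrightarrow> ctxt_closure R (App t s) (App t' s)"
| "ctxt_closure R s s' \<Longrightarrow> ctxt_closure R (App t s) (App t s')"
| "ctxt_closure R t t' \<Longrightarrow> ctxt_closure R (Pair t s) (Pair t' s)"
| "ctxt_closure R s s' \<Longrightarrow> ctxt_closure R (Pair t s) (Pair t s')"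
| "ctxt_closure R t t' \<Longrightarrow> ctxt_closure R (Pr1 t) (Pr1 t')"
| "ctxt_closure R t t' \<Longrightarrow> ctxt_closure R (Pr2 t) (Pr2 t')"
| "ctxt_closure R t t' \<Longrightarrow> ctxt_closure R (In1 t) (In1 t')"
| "ctxt_closure R t t' \<Longrightarrow> ctxt_closure R (In2 t) (In2 t')"
| "ctxt_closure R t t' \<Longrightarrow> ctxt_closure R (Case t t1 t2) (Case t' t1 t2)"
| "ctxt_closure R t1 t1' \<Longrightarrow> ctxt_closure R (Case t t1 t2) (Case t t1' t2)"
| "ctxt_closure R t2 t2' \<Longrightarrow> ctxt_closure R (Case t t1 t2) (Case t t1 t2')"
| "ctxt_closure R t t' \<Longrightarrow> ctxt_closure R (Bel (us @ t # vs) s) (Bel (us @ t' # vs) s)"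
| "ctxt_closure R s s' \<Longrightarrow> ctxt_closure R (Bel ts s) (Bel ts s')"

definition detour :: "tm \<Rightarrow> tm \<Rightarrow> bool" where
  "detour = ctxt_closure detour_rule"

definition permutation :: "tm \<Rightarrow> tm \<Rightarrow> bool" where
  "permutation = ctxt_closure perm_rule"

definition strongly_normalizing :: "('a \<Rightarrow> 'a \<Rightarrow> bool) \<Rightarrow> 'a \<Rightarrow> bool" where
  "strongly_normalizing R t \<longleftrightarrow> \<not> (\<exists>f :: nat \<Rightarrow> 'a. f 0 = t \<and> (\<forall>i. R (f i) (f (Suc i))))"

end

theory Submission
  imports Defs
begin

text \<open>
  Reducibility in the style of Prawitz's strong validity: \<open>RED A t\<close> is defined by recursion on \<open>A\<close>
  and, for each \<open>A\<close>, as a least fixed point under reducts and under branches of case distinctions,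
  with a condition on introduction terms. A permuted elimination is reducible because, apart from
  reductions inside its branches, each of its reducts is also a reduct of the same elimination applied
  to a reduct of the original case distinction.

  The delicate case is \<open>Bel\<close>. Merging an inner \<open>Bel\<close> exposes arguments whose types are unrelated to
  those of the outer term, so no induction on types applies to them. Instead the merged term is
  followed together with the unmerged arguments it came from, which are known to be reducible: a
  reduction of an exposed argument is a reduction of the inner \<open>Bel\<close>, and a permutation out of an
  exposed argument can be performed before the merge.
\<close>

subsection \<open>Renamings and substitutions\<close>

text \<open>A permutation carries an elimination into the branches of a case distinction before the
  scrutinee is known, so the branches must be reducible as open terms. A branch lies below one more
  binder, and whatever travels into it is weakened. Hence reducibility has to be invariant under
  renaming, and for this renamings have to reflect reductions. The conversion B_x t in x > t poses a
  further obstacle: it can return an exposed argument, for which no type is known although it must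
  turn out reducible at the type of the whole term. This is recovered by testing: arbitrary bodies
  are put where the body of that argument would go, and the fact that the outer body has collapsed
  to a variable shows what becomes of them.\<close>

lemma up_ren_comp: "up_ren n \<rho> \<circ> up_ren n \<rho>' = up_ren n (\<rho> \<circ> \<rho>')"
  by (auto simp: up_ren_def fun_eq_iff)

lemma ren_ren: "ren \<rho> (ren \<rho>' t) = ren (\<rho> \<circ> \<rho>') t"
  by (induction t arbitrary: \<rho> \<rho>') (simp_all add: up_ren_comp)

lemma up_sub_ren: "up_sub n \<sigma> \<circ> up_ren n \<rho> = up_sub n (\<sigma> \<circ> \<rho>)"
  by (auto simp: up_ren_def up_sub_def fun_eq_iff)

lemma sub_ren: "sub \<sigma> (ren \<rho> t) = sub (\<sigma> \<circ> \<rho>) t"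
  by (induction t arbitrary: \<sigma> \<rho>) (simp_all add: up_sub_ren)

lemma ren_up_sub: "ren (up_ren n \<rho>) \<circ> up_sub n \<sigma> = up_sub n (ren \<rho> \<circ> \<sigma>)"
  by (auto simp: up_ren_def up_sub_def fun_eq_iff ren_ren intro!: arg_cong2[where f = ren])

lemma ren_sub: "ren \<rho> (sub \<sigma> t) = sub (ren \<rho> \<circ> \<sigma>) t"
  by (induction t arbitrary: \<sigma> \<rho>) (simp_all add: ren_up_sub)

lemma sub_up_sub: "sub (up_sub n \<tau>) \<circ> up_sub n \<sigma> = up_sub n (sub \<tau> \<circ> \<sigma>)"
  by (auto simp: up_sub_def fun_eq_iff sub_ren ren_sub intro!: arg_cong2[where f = sub])

lemma sub_sub: "sub \<tau> (sub \<sigma> t) = sub (sub \<tau> \<circ> \<sigma>) t"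
  by (induction t arbitrary: \<sigma> \<tau>) (simp_all add: sub_up_sub)

lemma up_sub_Var: "up_sub n (\<lambda>i. Var (\<rho> i)) = (\<lambda>i. Var (up_ren n \<rho> i))"
  by (auto simp: up_ren_def up_sub_def fun_eq_iff)

text \<open>Through this identity the laws proved for substitutions are reused for
  renamings.\<close>

lemma ren_eq_sub: "ren \<rho> t = sub (\<lambda>i. Var (\<rho> i)) t"
  by (induction t arbitrary: \<rho>) (simp_all add: up_sub_Var)

lemma up_sub_id: "up_sub n Var = Var"
  by (auto simp: up_sub_def fun_eq_iff)

lemma sub_Var: "sub Var t = t"
  by (induction t) (simp_all add: up_sub_id map_idI)

lemma ren_id: "ren (\<lambda>i. i) t = t"
  by (simp add: ren_eq_sub comp_def sub_Var)

lemma wk_1: "wk 1 t = ren Suc t"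
  by (auto simp: wk_def intro: arg_cong2[where f = ren])

lemma sub_subst0: "sub \<sigma> (subst0 s t) = subst0 (sub \<sigma> s) (sub (up_sub 1 \<sigma>) t)"
  by (auto simp: subst0_def sub_sub fun_eq_iff up_sub_def sub_ren comp_def sub_Var
      split: nat.split intro!: arg_cong2[where f = sub])

lemma sub_wk: "sub (up_sub n \<sigma>) (wk n t) = wk n (sub \<sigma> t)"
  by (auto simp: wk_def sub_ren ren_sub up_sub_def fun_eq_iff intro!: arg_cong2[where f = sub])

lemma sub_wk_above:
  "sub (up_sub k (up_sub 1 \<sigma>)) (wk_above k t) = wk_above k (sub (up_sub k \<sigma>) t)"
  by (auto simp: wk_above_def sub_ren ren_sub up_sub_def up_ren_def fun_eq_iff ren_ren
      intro!: arg_cong2[where f = sub] arg_cong2[where f = ren])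

lemma sub_cong: "(\<And>i. \<sigma> i = \<tau> i) \<Longrightarrow> sub \<sigma> t = sub \<tau> t"
  by (rule arg_cong2[where f = sub]) auto

lemma sub_merge_body:
  "sub (up_sub (p + m + q) \<sigma>) (merge_body p m q t r)
    = merge_body p m q (sub (up_sub m \<sigma>) t) (sub (up_sub (p + 1 + q) \<sigma>) r)"
  unfolding merge_body_def sub_sub
proof (rule sub_cong)
  fix j
  \<comment> \<open>Outer binders before the inner \<open>Bel\<close>, the binder that is replaced,
    outer binders after it, and free variables. The latter start at \<open>p + 1 + q\<close> before
    the merge and at \<open>p + m + q\<close> after it.\<close>
  consider "j < p" | "j = p" | "p < j" "j < p + 1 + q" | k where "j = p + 1 + q + k"
    by (metis less_iff_Suc_add linorder_less_linear not_less le_iff_add)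
  then show "(sub (up_sub (p + m + q) \<sigma>) \<circ> (\<lambda>j. if j < p then Var j
      else if j = p then ren (\<lambda>k. if k < m then p + k else p + q + k) t else Var (j + m - 1))) j =
    (sub (\<lambda>j. if j < p then Var j
      else if j = p then ren (\<lambda>k. if k < m then p + k else p + q + k) (sub (up_sub m \<sigma>) t)
      else Var (j + m - 1)) \<circ> up_sub (p + 1 + q) \<sigma>) j"
  proof cases
    case 2
    show ?thesis
      using 2 by (auto simp: sub_ren ren_sub up_sub_def ren_ren comp_def add.commute add.left_commute
          intro!: sub_cong)
  next
    case 4
    then show ?thesis
      by (simp add: up_sub_def sub_sub comp_def ren_eq_sub add.commute add.left_commute)
  qed (auto simp: up_sub_def)
qed

section \<open>Reduction steps under substitution\<close>

abbreviation step :: "tm \<Rightarrow> tm \<Rightarrow> bool"  (infix "\<leadsto>" 50) where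
  "step \<equiv> ctxt_closure (\<lambda>t u. detour_rule t u \<or> perm_rule t u)"

lemma detour_rule_sub: "detour_rule t u \<Longrightarrow> detour_rule (sub \<sigma> t) (sub \<sigma> u)"
proof (induction rule: detour_rule.induct)
  case (6 us ss t vs r)
  have *: "length (us @ ss @ vs) = length us + length ss + length vs"
    "length (us @ Bel ss t # vs) = length us + 1 + length vs"
    by simp_all
  show ?case
    using detour_rule.intros(6)[of "map (sub \<sigma>) us" "map (sub \<sigma>) ss" "sub (up_sub (length ss) \<sigma>) t"
        "map (sub \<sigma>) vs" "sub (up_sub (length us + 1 + length vs) \<sigma>) r"]
    unfolding sub.simps * sub_merge_body by simp
qed (auto simp: sub_subst0 up_sub_def intro: detour_rule.intros)

lemma perm_rule_sub: "perm_rule t u \<Longrightarrow> perm_rule (sub \<sigma> t) (sub \<sigma> u)"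
proof (induction rule: perm_rule.induct)
  case (4 t t1 t2 s1 s2)
  show ?case
    unfolding sub.simps sub_wk_above by (rule perm_rule.intros)
next
  case (5 us t s1 s2 vs s)
  have *: "map (sub (up_sub 1 \<sigma>)) (map (wk 1) xs) = map (wk 1) (map (sub \<sigma>) xs)" for xs
    by (simp only: map_map comp_def sub_wk)
  have **: "length (map (wk 1) us @ t # map (wk 1) vs) = length us + 1 + length vs"
    "length (us @ t # vs) = length us + 1 + length vs" for t
    by simp_all
  show ?case
    unfolding sub.simps list.map map_append * ** sub_wk_above
    using perm_rule.intros(5)[of "map (sub \<sigma>) us" "sub \<sigma> t" "sub (up_sub 1 \<sigma>) s1"
        "sub (up_sub 1 \<sigma>) s2" "map (sub \<sigma>) vs" "sub (up_sub (length us + 1 + length vs) \<sigma>) s"]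
    unfolding length_map .
next
  case (1 t t1 t2 s)
  show ?case
    unfolding sub.simps sub_wk by (rule perm_rule.intros)
qed (unfold sub.simps, (rule perm_rule.intros)+)

lemma step_sub: "t \<leadsto> u \<Longrightarrow> sub \<sigma> t \<leadsto> sub \<sigma> u"
proof (induction arbitrary: \<sigma> rule: ctxt_closure.induct)
  case (1 t t')
  then show ?case
    using ctxt_closure.intros(1) detour_rule_sub perm_rule_sub by (metis (mono_tags, lifting))
next
  case (14 t t' us vs s)
  have "length (us @ t # vs) = length (us @ t' # vs)"
    by simp
  then show ?case
    unfolding sub.simps map_append list.map using ctxt_closure.intros(14)[OF 14(2)] by simp
qed (unfold sub.simps, (rule ctxt_closure.intros(2-13,15), assumption)+)

lemma step_ren: "t \<leadsto> u \<Longrightarrow> ren \<rho> t \<leadsto> ren \<rho> u"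
  by (simp add: ren_eq_sub step_sub)

subsection \<open>Renamings reflect reductions\<close>

lemma ren_subst0: "ren \<rho> (subst0 s t) = subst0 (ren \<rho> s) (ren (up_ren 1 \<rho>) t)"
  unfolding ren_eq_sub sub_subst0 up_sub_Var ..

lemma ren_wk: "ren (up_ren n \<rho>) (wk n t) = wk n (ren \<rho> t)"
  using sub_wk[of n "\<lambda>i. Var (\<rho> i)"] by (simp add: up_sub_Var ren_eq_sub)

lemma ren_wk_above:
  "ren (up_ren k (up_ren 1 \<rho>)) (wk_above k t) = wk_above k (ren (up_ren k \<rho>) t)"
  unfolding ren_eq_sub sub_wk_above up_sub_Var[symmetric] ..

lemma ren_merge_body:
  "ren (up_ren (p + m + q) \<rho>) (merge_body p m q t r)
    = merge_body p m q (ren (up_ren m \<rho>) t) (ren (up_ren (p + 1 + q) \<rho>) r)"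
  unfolding ren_eq_sub up_sub_Var[symmetric] sub_merge_body ..

lemma ren_eq_iffs:
  "ren \<rho> t = Var i \<longleftrightarrow> (\<exists>j. t = Var j \<and> i = \<rho> j)"
  "ren \<rho> t = Lam u \<longleftrightarrow> (\<exists>a. t = Lam a \<and> u = ren (up_ren 1 \<rho>) a)"
  "ren \<rho> t = App u v \<longleftrightarrow> (\<exists>a b. t = App a b \<and> u = ren \<rho> a \<and> v = ren \<rho> b)"
  "ren \<rho> t = Pair u v \<longleftrightarrow> (\<exists>a b. t = Pair a b \<and> u = ren \<rho> a \<and> v = ren \<rho> b)"
  "ren \<rho> t = Pr1 u \<longleftrightarrow> (\<exists>a. t = Pr1 a \<and> u = ren \<rho> a)"
  "ren \<rho> t = Pr2 u \<longleftrightarrow> (\<exists>a. t = Pr2 a \<and> u = ren \<rho> a)"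
  "ren \<rho> t = In1 u \<longleftrightarrow> (\<exists>a. t = In1 a \<and> u = ren \<rho> a)"
  "ren \<rho> t = In2 u \<longleftrightarrow> (\<exists>a. t = In2 a \<and> u = ren \<rho> a)"
  "ren \<rho> t = Case u v w \<longleftrightarrow> (\<exists>a b c. t = Case a b c \<and> u = ren \<rho> a \<and>
    v = ren (up_ren 1 \<rho>) b \<and> w = ren (up_ren 1 \<rho>) c)"
  "ren \<rho> t = Bel us s \<longleftrightarrow> (\<exists>ts r. t = Bel ts r \<and> us = map (ren \<rho>) ts \<and>
    s = ren (up_ren (length ts) \<rho>) r)"
  by (cases t; auto)+

lemmas eq_ren_iffs = ren_eq_iffs[unfolded eq_commute[of "ren _ _"]]

lemma detour_rule_ren_inv: "detour_rule (ren \<rho> t) u \<Longrightarrow> \<exists>t'. detour_rule t t' \<and> u = ren \<rho> t'"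
proof (induction "ren \<rho> t" u rule: detour_rule.induct)
  case (6 us' ss' a' vs' r')
  then obtain us ss a vs r where t: "t = Bel (us @ Bel ss a # vs) r"
    and *: "us' = map (ren \<rho>) us" "ss' = map (ren \<rho>) ss" "vs' = map (ren \<rho>) vs"
      "a' = ren (up_ren (length ss) \<rho>) a" "r' = ren (up_ren (length us + 1 + length vs) \<rho>) r"
    by (auto simp: ren_eq_iffs eq_ren_iffs map_eq_append_conv append_eq_map_conv Cons_eq_map_conv)
  have **: "length (us @ ss @ vs) = length us + length ss + length vs"
    by simp
  show ?case
    unfolding t * by (intro exI conjI, rule detour_rule.intros)
      (simp only: ren.simps ** ren_merge_body map_append length_map)
next
  case (7 a')
  then obtain a r where t: "t = Bel [a] r" "a' = ren \<rho> a" "Var 0 = ren (up_ren 1 \<rho>) r"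
    by (auto simp: ren_eq_iffs eq_ren_iffs Cons_eq_map_conv)
  \<comment> \<open>\<open>up_ren 1\<close> fixes 0 and sends every other index above 0, so even a
    non-injective renaming creates no redex of the unit conversion.\<close>
  from t(3)[symmetric] have "r = Var 0"
    by (auto simp: ren_eq_iffs eq_ren_iffs up_ren_def split: if_splits)
  then show ?case
    using t(1,2) by (blast intro: detour_rule.intros)
qed (auto simp: ren_eq_iffs eq_ren_iffs,
    (rule exI, rule conjI, rule detour_rule.intros, simp add: ren_subst0)+)

lemma perm_rule_ren_inv: "perm_rule (ren \<rho> t) u \<Longrightarrow> \<exists>t'. perm_rule t t' \<and> u = ren \<rho> t'"
proof (induction "ren \<rho> t" u rule: perm_rule.induct)
  case (1 a' b' c' s')
  then obtain a b c s where t: "t = App (Case a b c) s" 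
    and *: "a' = ren \<rho> a" "b' = ren (up_ren 1 \<rho>) b" "c' = ren (up_ren 1 \<rho>) c" "s' = ren \<rho> s"
    using 1 by (auto simp: ren_eq_iffs eq_ren_iffs)
  show ?case
    unfolding t * by (intro exI conjI, rule perm_rule.intros) (simp only: ren.simps ren_wk)
next
  case (4 a' b' c' s1' s2')
  then obtain a b c s1 s2 where t: "t = Case (Case a b c) s1 s2" 
    and *: "a' = ren \<rho> a" "b' = ren (up_ren 1 \<rho>) b" "c' = ren (up_ren 1 \<rho>) c" 
     "s1' = ren (up_ren 1 \<rho>) s1" "s2' = ren (up_ren 1 \<rho>) s2"
    using 4 by (auto simp: ren_eq_iffs eq_ren_iffs)
  show ?case
    unfolding t * by (intro exI conjI, rule perm_rule.intros) (simp only: ren.simps ren_wk_above)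
next
  case (5 us' a' b' c' vs' s')
  then obtain us a b c vs s where t: "t = Bel (us @ Case a b c # vs) s"
    and *: "us' = map (ren \<rho>) us" "vs' = map (ren \<rho>) vs" "a' = ren \<rho> a"
      "b' = ren (up_ren 1 \<rho>) b" "c' = ren (up_ren 1 \<rho>) c"
      "s' = ren (up_ren (length us + 1 + length vs) \<rho>) s"
    using 5 by (auto simp: ren_eq_iffs eq_ren_iffs append_eq_map_conv Cons_eq_map_conv)
  have **: "length (map (wk 1) us @ t # map (wk 1) vs) = length us + 1 + length vs" for t
    by simp
  have ***: "map (ren (up_ren 1 \<rho>)) (map (wk 1) xs) = map (wk 1) (map (ren \<rho>) xs)" for xs
    by (simp only: map_map comp_def ren_wk)
  show ?case
    unfolding t * by (intro exI conjI, rule perm_rule.intros)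
      (simp only: ren.simps ** *** ren_wk_above map_append list.map length_map)
qed (auto simp: ren_eq_iffs eq_ren_iffs,
    (rule exI, rule conjI, rule perm_rule.intros, simp)+)


text \<open>Replacing variables by variables changes no term constructor, so no redex is created,
  whatever the renaming identifies. This is what carries accessibility over to renamed
  terms.\<close>

lemma step_ren_inv: "ren \<rho> t \<leadsto> u \<Longrightarrow> \<exists>t'. t \<leadsto> t' \<and> u = ren \<rho> t'"
proof (induction "ren \<rho> t" u arbitrary: t \<rho> rule: ctxt_closure.induct)
  case (1 u)
  then show ?case
    using detour_rule_ren_inv perm_rule_ren_inv ctxt_closure.intros(1) by (metis (mono_tags, lifting))
next
  case (14 a' u us' vs' s')
  then obtain us a vs s where t: "t = Bel (us @ a # vs) s"
    and *: "us' = map (ren \<rho>) us" "vs' = map (ren \<rho>) vs" "a' = ren \<rho> a"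
      "s' = ren (up_ren (length us + 1 + length vs) \<rho>) s"
    using 14(3) by (auto simp: ren_eq_iffs eq_ren_iffs append_eq_map_conv Cons_eq_map_conv)
  from 14(2)[OF *(3)] obtain b where "a \<leadsto> b" "u = ren \<rho> b" by blast
  then show ?case
    unfolding t * by (intro exI[of _ "Bel (us @ b # vs) s"] conjI ctxt_closure.intros(14)) auto
next
  case (2 u v)
  then obtain a where t: "t = Lam a" "u = ren (up_ren 1 \<rho>) a"
    by (auto simp: eq_ren_iffs)
  with 2(2) obtain a' where "a \<leadsto> a'" "v = ren  (up_ren 1 \<rho>) a'"
    by blast
  with 2(3) t show ?case
    by (intro exI[of _ "Lam a'"]) (simp add: ctxt_closure.intros(2))
next
  case (3 u v s)
  then obtain a b where t: "t = App a b" "u = ren \<rho> a"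
    by (auto simp: eq_ren_iffs)
  with 3(2) obtain a' where "a \<leadsto> a'" "v = ren  \<rho> a'"
    by blast
  with 3(3) t show ?case
    by (intro exI[of _ "App a' b"]) (simp add: ctxt_closure.intros(3))
next
  case (4 u v s)
  then obtain b a where t: "t = App b a" "u = ren \<rho> a"
    by (auto simp: eq_ren_iffs)
  with 4(2) obtain a' where "a \<leadsto> a'" "v = ren  \<rho> a'"
    by blast
  with 4(3) t show ?case
    by (intro exI[of _ "App b a'"]) (simp add: ctxt_closure.intros(4))
next
  case (5 u v s)
  then obtain a b where t: "t = Pair a b" "u = ren \<rho> a"
    by (auto simp: eq_ren_iffs)
  with 5(2) obtain a' where "a \<leadsto> a'" "v = ren  \<rho> a'"
    by blast
  with 5(3) t show ?case
    by (intro exI[of _ "Pair a' b"]) (simp add: ctxt_closure.intros(5))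
next
  case (6 u v s)
  then obtain b a where t: "t = Pair b a" "u = ren \<rho> a"
    by (auto simp: eq_ren_iffs)
  with 6(2) obtain a' where "a \<leadsto> a'" "v = ren  \<rho> a'"
    by blast
  with 6(3) t show ?case
    by (intro exI[of _ "Pair b a'"]) (simp add: ctxt_closure.intros(6))
next
  case (7 u v)
  then obtain a where t: "t = Pr1 a" "u = ren \<rho> a"
    by (auto simp: eq_ren_iffs)
  with 7(2) obtain a' where "a \<leadsto> a'" "v = ren  \<rho> a'"
    by blast
  with 7(3) t show ?case
    by (intro exI[of _ "Pr1 a'"]) (simp add: ctxt_closure.intros(7))
next
  case (8 u v)
  then obtain a where t: "t = Pr2 a" "u = ren \<rho> a"
    by (auto simp: eq_ren_iffs)
  with 8(2) obtain a' where "a \<leadsto> a'" "v = ren  \<rho> a'"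
    by blast
  with 8(3) t show ?case
    by (intro exI[of _ "Pr2 a'"]) (simp add: ctxt_closure.intros(8))
next
  case (9 u v)
  then obtain a where t: "t = In1 a" "u = ren \<rho> a"
    by (auto simp: eq_ren_iffs)
  with 9(2) obtain a' where "a \<leadsto> a'" "v = ren  \<rho> a'"
    by blast
  with 9(3) t show ?case
    by (intro exI[of _ "In1 a'"]) (simp add: ctxt_closure.intros(9))
next
  case (10 u v)
  then obtain a where t: "t = In2 a" "u = ren \<rho> a"
    by (auto simp: eq_ren_iffs)
  with 10(2) obtain a' where "a \<leadsto> a'" "v = ren  \<rho> a'"
    by blast
  with 10(3) t show ?case
    by (intro exI[of _ "In2 a'"]) (simp add: ctxt_closure.intros(10))
next
  case (11 u v s1 s2)
  then obtain a b c where t: "t = Case a b c" "u = ren \<rho> a"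
    by (auto simp: eq_ren_iffs)
  with 11(2) obtain a' where "a \<leadsto> a'" "v = ren  \<rho> a'"
    by blast
  with 11(3) t show ?case
    by (intro exI[of _ "Case a' b c"]) (simp add: ctxt_closure.intros(11))
next
  case (12 u v s1 s2)
  then obtain b a c where t: "t = Case b a c" "u = ren (up_ren 1 \<rho>) a"
    by (auto simp: eq_ren_iffs)
  with 12(2) obtain a' where "a \<leadsto> a'" "v = ren  (up_ren 1 \<rho>) a'"
    by blast
  with 12(3) t show ?case
    by (intro exI[of _ "Case b a' c"]) (simp add: ctxt_closure.intros(12))
next
  case (13 u v s1 s2)
  then obtain b c a where t: "t = Case b c a" "u = ren (up_ren 1 \<rho>) a"
    by (auto simp: eq_ren_iffs)
  with 13(2) obtain a' where "a \<leadsto> a'" "v = ren  (up_ren 1 \<rho>) a'"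
    by blast
  with 13(3) t show ?case
    by (intro exI[of _ "Case b c a'"]) (simp add: ctxt_closure.intros(13))
next
  case (15 u v ts)
  then obtain bs a where t: "t = Bel bs a" "u = ren (up_ren (length bs) \<rho>) a"
    by (auto simp: eq_ren_iffs)
  with 15(2) obtain a' where "a \<leadsto> a'" "v = ren  (up_ren (length bs) \<rho>) a'"
    by blast
  with 15(3) t show ?case
    by (intro exI[of _ "Bel bs a'"]) (simp add: ctxt_closure.intros(15))
qed

subsection \<open>Reducibility\<close>

lemma not_step_Var: "\<not> Var i \<leadsto> u"
  by (auto elim: ctxt_closure.cases detour_rule.cases perm_rule.cases)

lemma step_LamE: "Lam t \<leadsto> u \<Longrightarrow> (\<And>t'. t \<leadsto> t' \<Longrightarrow> u = Lam t' \<Longrightarrow> P) \<Longrightarrow> P"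
  by (auto elim: ctxt_closure.cases detour_rule.cases perm_rule.cases)

lemma step_PairE:
  assumes "Pair t s \<leadsto> u"
  obtains t' where "t \<leadsto> t'" "u = Pair t' s" | s' where "s \<leadsto> s'" "u = Pair t s'"
  using assms by (auto elim: ctxt_closure.cases detour_rule.cases perm_rule.cases)

lemma step_In1E: "In1 t \<leadsto> u \<Longrightarrow> (\<And>t'. t \<leadsto> t' \<Longrightarrow> u = In1 t' \<Longrightarrow> P) \<Longrightarrow> P"
  by (auto elim: ctxt_closure.cases detour_rule.cases perm_rule.cases)

lemma step_In2E: "In2 t \<leadsto> u \<Longrightarrow> (\<And>t'. t \<leadsto> t' \<Longrightarrow> u = In2 t' \<Longrightarrow> P) \<Longrightarrow> P"
  by (auto elim: ctxt_closure.cases detour_rule.cases perm_rule.cases)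

lemma step_AppE:
  assumes "App t s \<leadsto> u"
  obtains (arg1) t' where "t \<leadsto> t'" "u = App t' s"
  | (arg2) s' where "s \<leadsto> s'" "u = App t s'"
  | (beta) b where "t = Lam b" "u = subst0 s b"
  | (perm) a b c where "t = Case a b c" "u = Case a (App b (wk 1 s)) (App c (wk 1 s))"
  using assms
  by cases (auto simp del: One_nat_def elim!: detour_rule.cases perm_rule.cases dest: that)

lemma step_Pr1E:
  assumes "Pr1 t \<leadsto> u"
  obtains (arg) t' where "t \<leadsto> t'" "u = Pr1 t'"
  | (beta) b where "t = Pair u b"
  | (perm) a b c where "t = Case a b c" "u = Case a (Pr1 b) (Pr1 c)"
  using assms
  by cases (auto simp del: One_nat_def elim!: detour_rule.cases perm_rule.cases dest: that)

lemma step_Pr2E: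
  assumes "Pr2 t \<leadsto> u"
  obtains (arg) t' where "t \<leadsto> t'" "u = Pr2 t'"
  | (beta) b where "t = Pair b u"
  | (perm) a b c where "t = Case a b c" "u = Case a (Pr2 b) (Pr2 c)"
  using assms
  by cases (auto simp del: One_nat_def elim!: detour_rule.cases perm_rule.cases dest: that)

lemma step_CaseE:
  assumes "Case a t1 t2 \<leadsto> u"
  obtains (scrut) a' where "a \<leadsto> a'" "u = Case a' t1 t2"
  | (branch1) t1' where "t1 \<leadsto> t1'" "u = Case a t1' t2"
  | (branch2) t2' where "t2 \<leadsto> t2'" "u = Case a t1 t2'"
  | (In1) p where "a = In1 p" "u = subst0 p t1"
  | (In2) p where "a = In2 p" "u = subst0 p t2"
  | (perm) d b c where "a = Case d b c"
      "u = Case d (Case b (wk_above 1 t1) (wk_above 1 t2)) (Case c (wk_above 1 t1) (wk_above 1 t2))"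
  using assms
  by cases (auto simp del: One_nat_def elim!: detour_rule.cases perm_rule.cases dest: that)

lemma step_BelE:
  assumes "Bel ts r \<leadsto> u"
  obtains (arg) us t t' vs where "ts = us @ t # vs" "t \<leadsto> t'" "u = Bel (us @ t' # vs) r"
  | (body) r' where "r \<leadsto> r'" "u = Bel ts r'"
  | (merge) us ss t vs where "ts = us @ Bel ss t # vs"
      "u = Bel (us @ ss @ vs) (merge_body (length us) (length ss) (length vs) t r)"
  | (unit) "ts = [u]" "r = Var 0"
  | (perm) us a b c vs where "ts = us @ Case a b c # vs"
      "u = Case a
        (Bel (map (wk 1) us @ b # map (wk 1) vs) (wk_above (length us + 1 + length vs) r))
        (Bel (map (wk 1) us @ c # map (wk 1) vs) (wk_above (length us + 1 + length vs) r))"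
  using assms
proof (cases rule: ctxt_closure.cases)
  case 1
  then have "detour_rule (Bel ts r) u \<or> perm_rule (Bel ts r) u" by simp
  then show thesis
  proof
    assume "detour_rule (Bel ts r) u"
    then show thesis by cases (use merge unit in auto)
  next
    assume "perm_rule (Bel ts r) u"
    then show thesis by cases (use perm in auto)
  qed
qed (use arg body in auto)

lemma detour_step: "detour_rule t u \<Longrightarrow> t \<leadsto> u"
  and perm_step: "perm_rule t u \<Longrightarrow> t \<leadsto> u"
  by (rule ctxt_closure.intros(1), simp)+

text \<open>Branches of a case distinction count as descendants, as in Prawitz's notion of strong validity.\<close>

inductive dsc :: "tm \<Rightarrow> tm \<Rightarrow> bool" where
  dsc_step: "t \<leadsto> t' \<Longrightarrow> dsc t t'"
| dsc_branch1: "dsc (Case a t1 t2) t1"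
| dsc_branch2: "dsc (Case a t1 t2) t2"

text \<open>\<open>\<rho>'\<close> is \<open>\<rho>\<close> for a reduction step and
  \<open>up_ren 1 \<rho>\<close> for a branch, which lies below a binder.\<close>

lemma dsc_ren_inv: "dsc (ren \<rho> t) u \<Longrightarrow> \<exists>t' \<rho>'. dsc t t' \<and> u = ren \<rho>' t'"
proof (erule dsc.cases)
  fix v w assume "ren \<rho> t = v" "u = w" "v \<leadsto> w"
  then show ?thesis by (blast dest: step_ren_inv intro: dsc_step)
next
  fix a t1 t2 assume "ren \<rho> t = Case a t1 t2" "u = t1"
  then show ?thesis by (force simp: ren_eq_iffs intro: dsc_branch1)
next
  fix a t1 t2 assume "ren \<rho> t = Case a t1 t2" "u = t2"
  then show ?thesis by (force simp: ren_eq_iffs intro: dsc_branch2)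
qed

text \<open>With \<open>bs = [s]\<close> and \<open>\<rho>\<close> the identity this is the
  substitution of a beta step; with a shift for \<open>\<rho>\<close> it produces the body of a
  merged \<open>Bel\<close>.\<close>

definition senv :: "tm list \<Rightarrow> (nat \<Rightarrow> nat) \<Rightarrow> nat \<Rightarrow> tm" where
  "senv bs \<rho> = (\<lambda>i. if i < length bs then bs ! i else Var (\<rho> (i - length bs)))"

lemma subst0_senv: "subst0 s t = sub (senv [s] (\<lambda>i. i)) t"
  by (auto simp: subst0_def senv_def split: nat.split intro!: sub_cong)

lemma sub_senv_ren: "length bs = n \<Longrightarrow> sub (senv bs \<rho>) (ren (up_ren n \<tau>) t) = sub (senv bs (\<rho> \<circ> \<tau>)) t"
  by (auto simp: sub_ren senv_def up_ren_def intro!: sub_cong)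

lemma sub_senv_up_sub:
  "length bs = n \<Longrightarrow> sub (senv bs \<rho>) (sub (up_sub n \<sigma>) t) =
    sub (\<lambda>i. if i < n then bs ! i else ren \<rho> (\<sigma> (i - n))) t"
  by (auto simp: sub_sub sub_ren senv_def up_sub_def ren_eq_sub intro!: sub_cong)

section \<open>Reducibility predicates\<close>

inductive red_gen :: "(tm \<Rightarrow> bool) \<Rightarrow> tm \<Rightarrow> bool" for I where
  red_genI: "(\<And>t'. dsc t t' \<Longrightarrow> red_gen I t') \<Longrightarrow> I t \<Longrightarrow> red_gen I t"

text \<open>The \<open>\<rho>\<close> in the arrow clause is a Kripke-style quantification: a
  renaming of \<open>b\<close> is absorbed into it, which gives \<open>RED_ren\<close>. The box
  clause speaks of the open body, since merging a \<open>Bel\<close> into an outer one keeps its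
  binders bound, and replacing one of them by a nested merge is itself a reduction of the term. The
  arguments have no types determined by \<open>Box A\<close>; they are controlled through the
  descendants of the whole \<open>Bel\<close>.\<close>

primrec RED :: "ty \<Rightarrow> tm \<Rightarrow> bool" where
  "RED (Atom n) = red_gen (\<lambda>t. True)"
| "RED (Arrow A B) = red_gen (\<lambda>t. \<forall>b \<rho> u. t = Lam b \<longrightarrow> RED A u \<longrightarrow> RED B (sub (senv [u] \<rho>) b))"
| "RED (Prod A B) = red_gen (\<lambda>t. \<forall>a b. t = Pair a b \<longrightarrow> RED A a \<and> RED B b)"
| "RED (Sum A B) = red_gen (\<lambda>t. \<forall>a. (t = In1 a \<longrightarrow> RED A a) \<and> (t = In2 a \<longrightarrow> RED B a))"
| "RED (Box A) = red_gen (\<lambda>t. \<forall>ts s. t = Bel ts s \<longrightarrow> RED A s)"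

lemma red_gen_simp: "red_gen I t \<longleftrightarrow> (\<forall>t'. dsc t t' \<longrightarrow> red_gen I t') \<and> I t"
  by (blast intro: red_genI elim: red_gen.cases)

lemma RED_dsc: "RED A t \<Longrightarrow> dsc t t' \<Longrightarrow> RED A t'"
  by (cases A) (simp_all, (blast elim: red_gen.cases)+)

lemma RED_step: "RED A t \<Longrightarrow> t \<leadsto> t' \<Longrightarrow> RED A t'"
  by (blast intro: RED_dsc dsc_step)

lemma RED_steps: "step\<^sup>*\<^sup>* t t' \<Longrightarrow> RED A t \<Longrightarrow> RED A t'"
  by (induction rule: rtranclp_induct) (auto intro: RED_step)

lemma RED_induct [consumes 1, case_names desc]:
  assumes "RED A t"
    and IH: "\<And>t. RED A t \<Longrightarrow> (\<And>t'. dsc t t' \<Longrightarrow> P t') \<Longrightarrow> P t"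
  shows "P t"
proof -
  \<comment> \<open>Every clause of \<open>RED\<close> is a \<open>red_gen\<close>, so a single
    induction serves all types.\<close>
  have "P t" if "RED A = red_gen I" "red_gen I t" for I
    using that(2)
  proof induction
    case (red_genI t)
    then show ?case
      using IH that(1) by (metis red_gen.red_genI)
  qed
  with assms(1) show ?thesis
    by (cases A) auto
qed

text \<open>The conditions on introduction terms are vacuous here, so only the descendants
  matter.\<close>

lemma RED_neutral:
  assumes "\<And>t'. dsc t t' \<Longrightarrow> RED A t'"
    and "\<And>b. t \<noteq> Lam b" "\<And>a b. t \<noteq> Pair a b" "\<And>a. t \<noteq> In1 a" "\<And>a. t \<noteq> In2 a" "\<And>ts s. t \<noteq> Bel ts s"
  shows "RED A t"
  using assms by (cases A; simp; subst red_gen_simp; simp)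

lemma RED_Var: "RED A (Var i)"
  by (rule RED_neutral) (auto elim!: dsc.cases simp: not_step_Var)

lemma red_gen_ren:
  assumes "red_gen I t" and "\<And>t \<rho>. I t \<Longrightarrow> I (ren \<rho> t)"
  shows "red_gen I (ren \<rho> t)"
  using assms(1)
proof (induction arbitrary: \<rho>)
  case (red_genI t)
  show ?case
    by (rule red_gen.red_genI) (use red_genI assms(2) in \<open>blast dest: dsc_ren_inv\<close>)+
qed

lemma RED_ren: "RED A t \<Longrightarrow> RED A (ren \<rho> t)"
proof (induction A arbitrary: t \<rho>)
  case (Arrow A B)
  from Arrow.prems show ?case
    unfolding RED.simps by (rule red_gen_ren) (auto simp: ren_eq_iffs sub_senv_ren simp del: One_nat_def)
next
  case (Prod A B)
  from Prod.prems show ?case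
    unfolding RED.simps by (rule red_gen_ren) (auto simp: ren_eq_iffs intro: Prod.IH)
next
  case (Sum A B)
  from Sum.prems show ?case
    unfolding RED.simps by (rule red_gen_ren) (auto simp: ren_eq_iffs intro: Sum.IH)
next
  case (Box A)
  from Box.prems show ?case
    unfolding RED.simps by (rule red_gen_ren) (auto simp: ren_eq_iffs intro: Box.IH)
qed (auto intro: red_gen_ren)

section \<open>Validity of bodies under binders\<close>

definition valid :: "ty list \<Rightarrow> ty \<Rightarrow> tm \<Rightarrow> bool" where
  "valid As C r \<longleftrightarrow> (\<forall>bs \<rho>. list_all2 RED As bs \<longrightarrow> RED C (sub (senv bs \<rho>) r))"

lemma valid_RED: "valid As C r \<Longrightarrow> RED C r"
proof -
  assume "valid As C r"
  moreover have "list_all2 RED As (map Var [0..<length As])"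
    by (simp add: list_all2_conv_all_nth RED_Var)
  \<comment> \<open>Variables are reducible, and together with the shift they make up the identity
    substitution.\<close>
  moreover have "sub (senv (map Var [0..<length As]) (\<lambda>i. i + length As)) r = sub Var r"
    by (rule sub_cong) (simp add: senv_def)
  ultimately show ?thesis
    unfolding valid_def by (metis sub_Var)
qed

lemma valid_step: "valid As C r \<Longrightarrow> r \<leadsto> r' \<Longrightarrow> valid As C r'"
  unfolding valid_def by (blast intro: RED_step step_sub)

lemma valid_ren: "valid As C r \<Longrightarrow> valid As C (ren (up_ren (length As) \<tau>) r)"
  unfolding valid_def by (metis list_all2_lengthD sub_senv_ren)

lemma valid_subst0: "valid [A] C r \<Longrightarrow> RED A s \<Longrightarrow> RED C (subst0 s r)"
  unfolding valid_def subst0_senv by simp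

text \<open>No type is assumed for the scrutinee, so its reductions are left to the hypotheses and
  the induction is on the branches. Each hypothesis survives a reduction inside a branch, because
  the terms it speaks of reduce accordingly.\<close>

lemma RED_Case_gen:
  assumes "RED T X" "RED T Y"
    and "\<And>a'. a \<leadsto> a' \<Longrightarrow> RED T (Case a' X Y)"
    and "\<And>p. a = In1 p \<Longrightarrow> RED T (subst0 p X)"
    and "\<And>p. a = In2 p \<Longrightarrow> RED T (subst0 p Y)"
    and "\<And>d b c. a = Case d b c \<Longrightarrow>
      RED T (Case d (Case b (wk_above 1 X) (wk_above 1 Y)) (Case c (wk_above 1 X) (wk_above 1 Y)))"
  shows "RED T (Case a X Y)"
  using assms
proof (induction arbitrary: Y rule: RED_induct)
  case (desc X)
  note IHX = desc.IH
  from desc.prems desc.hyps show ?case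
  proof (induction rule: RED_induct)
    case (desc Y)
    show ?case
    proof (rule RED_neutral)
      fix t'
      assume "dsc (Case a X Y) t'"
      then show "RED T t'"
      proof cases
        case dsc_step
        then show ?thesis
        proof (cases rule: step_CaseE)
          case (branch1 X')
          have *: "subst0 p X \<leadsto> subst0 p X'" "wk_above k X \<leadsto> wk_above k X'" for p k
            using branch1(1) by (simp_all add: subst0_def wk_above_def step_sub step_ren)
          show ?thesis
            unfolding branch1(2)
          proof (rule IHX)
            show "dsc X X'" using branch1 by (simp add: dsc.intros)
            show "RED T (Case a' X' Y)" if "a \<leadsto> a'" for a'
              using RED_step[OF desc.prems(1)[OF that]] branch1(1) ctxt_closure.intros(12) by blast
            show "RED T (subst0 p X')" if "a = In1 p" for p
              using RED_step[OF desc.prems(2)[OF that] *(1)] .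
            fix d b c assume "a = Case d b c"
            from desc.prems(4)[OF this] show "RED T (Case d (Case b (wk_above 1 X') (wk_above 1 Y))
                (Case c (wk_above 1 X') (wk_above 1 Y)))"
              \<comment> \<open>The permutation copies the branch, so two steps are needed.\<close>
              by (rule RED_step[OF RED_step])
                (rule ctxt_closure.intros(12,13) *)+
          qed (use desc in auto)
        next
          case (branch2 Y')
          have *: "subst0 p Y \<leadsto> subst0 p Y'" "wk_above k Y \<leadsto> wk_above k Y'" for p k
            using branch2(1) by (simp_all add: subst0_def wk_above_def step_sub step_ren)
          show ?thesis
            unfolding branch2(2)
          proof (rule desc.IH)
            show "dsc Y Y'" using branch2 by (simp add: dsc.intros)
            show "RED T (Case a' X Y')" if "a \<leadsto> a'" for a'
              using RED_step[OF desc.prems(1)[OF that]] branch2(1) ctxt_closure.intros(13) by blast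
            show "RED T (subst0 p Y')" if "a = In2 p" for p
              using RED_step[OF desc.prems(3)[OF that] *(1)] .
            fix d b c assume "a = Case d b c"
            from desc.prems(4)[OF this] show "RED T (Case d (Case b (wk_above 1 X) (wk_above 1 Y'))
                (Case c (wk_above 1 X) (wk_above 1 Y')))"
              by (rule RED_step[OF RED_step])
                (rule ctxt_closure.intros(12,13) *)+
          qed (use desc in auto)
        qed (use desc in auto)
      qed (use desc in auto)
    qed auto
  qed
qed

section \<open>Permuting eliminations into branches\<close>

lemma subst0_wk: "subst0 p (wk 1 s) = s"
  unfolding subst0_senv wk_def sub_ren
  using sub_cong[of "senv [p] (\<lambda>i. i) \<circ> (\<lambda>k. k + 1)" Var s] by (simp add: senv_def sub_Var)

lemma sub_up_sub_wk_above: "sub (up_sub k (senv [p] (\<lambda>i. i))) (wk_above k s) = s"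
  unfolding subst0_senv wk_above_def sub_ren
  using sub_cong[of "up_sub k (senv [p] (\<lambda>i. i)) \<circ> up_ren k Suc" Var s]
  by (simp add: senv_def sub_Var up_sub_def up_ren_def)

lemma subst0_App: "subst0 p (App t s) = App (subst0 p t) (subst0 p s)"
  and subst0_Pr1: "subst0 p (Pr1 t) = Pr1 (subst0 p t)"
  and subst0_Pr2: "subst0 p (Pr2 t) = Pr2 (subst0 p t)"
  by (simp_all add: subst0_def)

lemma subst0_Case_wk_above:
  "subst0 p (Case b (wk_above 1 s1) (wk_above 1 s2)) = Case (subst0 p b) s1 s2"
  by (simp add: subst0_senv sub_up_sub_wk_above del: One_nat_def)

lemma subst0_Bel_wk:
  assumes "n = length us + 1 + length vs"
  shows "subst0 p (Bel (map (wk 1) us @ b # map (wk 1) vs) (wk_above n r)) = Bel (us @ subst0 p b # vs) r"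
proof -
  have "length (map (wk 1) us @ b # map (wk 1) vs) = n"
    using assms by simp
  moreover have "map (sub (senv [p] (\<lambda>i. i))) (map (wk 1) xs) = xs" for xs
    by (simp add: comp_def subst0_wk flip: subst0_senv del: One_nat_def)
  ultimately show ?thesis
    by (simp add: subst0_senv sub_up_sub_wk_above del: One_nat_def)
qed

text \<open>Neither inserted binder occurs in \<open>s\<close>, so their order does not show. Used
  where an elimination passes through two nested case distinctions.\<close>

lemma wk_above_wk: "wk_above 1 (wk 1 s) = wk 1 (wk 1 s)"
  by (auto simp: wk_above_def wk_def ren_ren up_ren_def fun_eq_iff intro!: arg_cong2[where f = ren])

lemma ren_wk_above_wk_above: "ren (up_ren k (up_ren 1 Suc)) (wk_above k s) = wk_above k (wk_above k s)"
  by (auto simp: wk_above_def ren_ren up_ren_def intro!: arg_cong2[where f = ren])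

lemma steps_map:
  assumes "\<And>t t'. t \<leadsto> t' \<Longrightarrow> f t \<leadsto> f t'" and "step\<^sup>*\<^sup>* t t'"
  shows "step\<^sup>*\<^sup>* (f t) (f t')"
  using assms(2) by induction (auto intro: assms(1) rtranclp.rtrancl_into_rtrancl)

lemma steps_Case:
  assumes "step\<^sup>*\<^sup>* b b'" "step\<^sup>*\<^sup>* c c'"
  shows "step\<^sup>*\<^sup>* (Case d b c) (Case d b' c')"
  using steps_map[of "\<lambda>b. Case d b c", OF ctxt_closure.intros(12) assms(1)]
    steps_map[of "\<lambda>c. Case d b' c", OF ctxt_closure.intros(13) assms(2)]
  by simp

text \<open>
  The permuted case distinction of an elimination \<open>F\<close>, with \<open>F'\<close> the weakened elimination: all its
  reducts outside the branches are reducts of \<open>F g'\<close> for reducts \<open>g'\<close> of the case distinction.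
\<close>

lemma RED_perm_frame:
  assumes IH: "\<And>g'. Case d b c \<leadsto> g' \<Longrightarrow> RED T (F g')"
    and branches: "RED T (F' b)" "RED T (F' c)"
    and perm: "\<And>d b c. F (Case d b c) \<leadsto> Case d (F' b) (F' c)"
    and subst: "\<And>p b. subst0 p (F' b) = F (subst0 p b)"
    and perm': "\<And>d b c. F' (Case d (wk_above 1 b) (wk_above 1 c)) \<leadsto>
      Case d (wk_above 1 (F' b)) (wk_above 1 (F' c))"
  shows "RED T (Case d (F' b) (F' c))"
proof (rule RED_Case_gen)
  fix d' assume "d \<leadsto> d'"
  then show "RED T (Case d' (F' b) (F' c))"
    using RED_step[OF IH perm] ctxt_closure.intros(11) by blast
next
  fix p assume "d = In1 p"
  then show "RED T (subst0 p (F' b))"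
    unfolding subst by (intro IH) (simp add: detour_step detour_rule.intros)
next
  fix p assume "d = In2 p"
  then show "RED T (subst0 p (F' c))"
    unfolding subst by (intro IH) (simp add: detour_step detour_rule.intros)
next
  fix e d1 d2 assume d: "d = Case e d1 d2"
  let ?C = "\<lambda>d. Case d (wk_above 1 b) (wk_above 1 c)"
  \<comment> \<open>The two case distinctions are permuted first; then \<open>F\<close> passes
    \<open>e\<close>, and the copies of \<open>F'\<close> pass \<open>d1\<close> and
    \<open>d2\<close>.\<close>
  have "RED T (F (Case e (?C d1) (?C d2)))"
    unfolding d by (intro IH) (simp add: d perm_step perm_rule.intros del: One_nat_def)
  moreover have "step\<^sup>*\<^sup>* (F (Case e (?C d1) (?C d2))) (Case e (F' (?C d1)) (F' (?C d2)))"
    using perm by blast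
  moreover have "step\<^sup>*\<^sup>* (Case e (F' (?C d1)) (F' (?C d2)))
      (Case e (Case d1 (wk_above 1 (F' b)) (wk_above 1 (F' c)))
              (Case d2 (wk_above 1 (F' b)) (wk_above 1 (F' c))))"
    by (intro steps_Case r_into_rtranclp perm')
  ultimately show "RED T (Case e (Case d1 (wk_above 1 (F' b)) (wk_above 1 (F' c)))
              (Case d2 (wk_above 1 (F' b)) (wk_above 1 (F' c))))"
    by (blast intro: RED_steps)
qed (fact branches)+

section \<open>Reducibility of eliminations\<close>

lemma RED_LamD: "RED (Arrow A B) (Lam b) \<Longrightarrow> RED A u \<Longrightarrow> RED B (sub (senv [u] \<rho>) b)"
  and RED_PairD: "RED (Prod A B) (Pair t s) \<Longrightarrow> RED A t \<and> RED B s"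
  and RED_In1D: "RED (Sum A B) (In1 t) \<Longrightarrow> RED A t"
  and RED_In2D: "RED (Sum A B) (In2 t) \<Longrightarrow> RED B t"
  and RED_BelD: "RED (Box A) (Bel ts s) \<Longrightarrow> RED A s"
  by (auto elim!: red_gen.cases)

declare RED.simps [simp del]

lemma RED_Pr1: "RED (Prod A B) t \<Longrightarrow> RED A (Pr1 t)"
proof (induction rule: RED_induct)
  case (desc t)
  show ?case
  proof (rule RED_neutral)
    fix t' assume "dsc (Pr1 t) t'"
    then show "RED A t'"
    proof cases
      case dsc_step
      then show ?thesis
      proof (cases rule: step_Pr1E)
        case (perm d b c)
        show ?thesis
          unfolding perm(2)
          by (rule RED_perm_frame[where F = Pr1 and F' = Pr1])
            (simp_all add: desc.IH[unfolded perm] perm dsc.intros perm_step perm_rule.intros subst0_Pr1 wk_above_def)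
      next
        case arg
        then show ?thesis
          using desc.IH dsc.intros(1) by blast
      next
        case beta
        then show ?thesis
          using desc.hyps RED_PairD by blast
      qed
    qed
  qed auto
qed

lemma RED_Pr2: "RED (Prod A B) t \<Longrightarrow> RED B (Pr2 t)"
proof (induction rule: RED_induct)
  case (desc t)
  show ?case
  proof (rule RED_neutral)
    fix t' assume "dsc (Pr2 t) t'"
    then show "RED B t'"
    proof cases
      case dsc_step
      then show ?thesis
      proof (cases rule: step_Pr2E)
        case (perm d b c)
        show ?thesis
          unfolding perm(2)
          by (rule RED_perm_frame[where F = Pr2 and F' = Pr2])
            (simp_all add: desc.IH[unfolded perm] perm dsc.intros perm_step perm_rule.intros subst0_Pr2 wk_above_def)
      next
        case arg
        then show ?thesis
          using desc.IH dsc.intros(1) by blast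
      next
        case beta
        then show ?thesis
          using desc.hyps RED_PairD by blast
      qed
    qed
  qed auto
qed

text \<open>\<open>s\<close> is arbitrary in the outer induction because the branches of a permuted
  application are applied to the weakening of \<open>s\<close>. The inner induction handles
  reductions of \<open>s\<close>.\<close>

lemma RED_App: "RED (Arrow A B) t \<Longrightarrow> RED A s \<Longrightarrow> RED B (App t s)"
proof (induction arbitrary: s rule: RED_induct)
  case (desc t)
  note IH = desc.IH
  from desc.prems desc.hyps show ?case
  proof (induction rule: RED_induct)
    case (desc s)
    show ?case
    proof (rule RED_neutral)
      fix t' assume "dsc (App t s) t'"
      then show "RED B t'"
      proof cases
        case dsc_step
        then show ?thesis
        proof (cases rule: step_AppE)
          case (beta b)
          then show ?thesis
            using RED_LamD desc by (simp add: subst0_senv)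
        next
          case (perm d b c)
          show ?thesis
            unfolding perm(2)
          proof (rule RED_perm_frame[where F = "\<lambda>t. App t s" and F' = "\<lambda>t. App t (wk 1 s)"])
            show "App (Case d (wk_above 1 b) (wk_above 1 c)) (wk 1 s) \<leadsto>
              Case d (wk_above 1 (App b (wk 1 s))) (wk_above 1 (App c (wk 1 s)))" for d b c
              using perm_step[OF perm_rule.intros(1)[of d "wk_above 1 b" "wk_above 1 c" "wk 1 s"]] wk_above_wk[of s]
              by (simp add: wk_above_def)
            have "RED A (wk 1 s)"
              using desc.hyps by (simp add: wk_def RED_ren)
            then show "RED B (App b (wk 1 s))" "RED B (App c (wk 1 s))"
              using IH perm(1) by (blast intro: dsc.intros)+
            show "RED B (App g s)" if "Case d b c \<leadsto> g" for g
              using IH desc.hyps that perm(1) by (blast intro: dsc.intros)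
          qed (simp_all only: subst0_App subst0_wk perm_step perm_rule.intros)
        next
          case arg1
          then show ?thesis
            using IH desc.hyps dsc.intros(1) by blast
        next
          case arg2
          then show ?thesis
            using desc.IH desc.prems dsc.intros(1) by blast
        qed
      qed
    qed auto
  qed
qed

lemma RED_Case:
  assumes "RED (Sum A B) a" "valid [A] T t1" "valid [B] T t2"
  shows "RED T (Case a t1 t2)"
  using assms
proof (induction arbitrary: t1 t2 rule: RED_induct)
  case (desc a)
  note IH = desc.IH[OF _ desc.prems]
  show ?case
  proof (rule RED_Case_gen)
    fix d b c assume a: "a = Case d b c"
    have v: "valid [A] T (wk_above 1 t1)" "valid [B] T (wk_above 1 t2)"
      using valid_ren[OF desc.prems(1)] valid_ren[OF desc.prems(2)] by (simp_all add: wk_above_def)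
    show "RED T (Case d (Case b (wk_above 1 t1) (wk_above 1 t2)) (Case c (wk_above 1 t1) (wk_above 1 t2)))"
    proof (rule RED_perm_frame[where F = "\<lambda>g. Case g t1 t2" 
          and F' = "\<lambda>g. Case g (wk_above 1 t1) (wk_above 1 t2)"])
      show "Case (Case d (wk_above 1 b) (wk_above 1 c)) (wk_above 1 t1) (wk_above 1 t2) \<leadsto>
       Case d (wk_above 1 (Case b (wk_above 1 t1) (wk_above 1 t2)))
        (wk_above 1 (Case c (wk_above 1 t1) (wk_above 1 t2)))" for d b c
        using perm_step[OF perm_rule.intros(4)[of d "wk_above 1 b" "wk_above 1 c" "wk_above 1 t1" "wk_above 1 t2"]]
        unfolding wk_above_def[of 1 "Case _ _ _"] ren.simps ren_wk_above_wk_above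
        unfolding wk_above_def[of 1 b] wk_above_def[of 1 c] .
      show "RED T (Case b (wk_above 1 t1) (wk_above 1 t2))" "RED T (Case c (wk_above 1 t1) (wk_above 1 t2))"
        by (rule desc.IH; simp add: a dsc.intros v del: One_nat_def)+
      show "RED T (Case g t1 t2)" if "Case d b c \<leadsto> g" for g
        using IH that a by (blast intro: dsc.intros)
    qed (simp_all only: subst0_Case_wk_above perm_step perm_rule.intros)
  next
    show "RED T (subst0 p t1)" if "a = In1 p" for p
      using desc.hyps desc.prems(1) that RED_In1D valid_subst0 by blast
    show "RED T (subst0 p t2)" if "a = In2 p" for p
      using desc.hyps desc.prems(2) that RED_In2D valid_subst0 by blast
    show "RED T (Case a' t1 t2)" if "a \<leadsto> a'" for a'
      using IH that by (blast intro: dsc.intros)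
  qed (use desc.prems valid_RED in blast)+
qed

section \<open>Reducibility of introductions\<close>

lemma dsc_introD:
  "dsc (Lam b) t' \<Longrightarrow> Lam b \<leadsto> t'" "dsc (Pair t s) t' \<Longrightarrow> Pair t s \<leadsto> t'"
  "dsc (In1 t) t' \<Longrightarrow> In1 t \<leadsto> t'" "dsc (In2 t) t' \<Longrightarrow> In2 t \<leadsto> t'"
  "dsc (Bel ts r) t' \<Longrightarrow> Bel ts r \<leadsto> t'"
  by (erule dsc.cases; simp)+

lemma RED_Lam: "valid [A] B b \<Longrightarrow> RED (Arrow A B) (Lam b)"
proof -
  assume "valid [A] B b"
  with valid_RED[OF this] show ?thesis
  proof (induction rule: RED_induct)
    case (desc b)
    have "RED (Arrow A B) t'" if "dsc (Lam b) t'" for t'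
      using dsc_introD(1)[OF that] by (rule step_LamE) (use desc valid_step dsc_step in blast)
    moreover have "RED B (sub (senv [u] \<rho>) b)" if "RED A u" for u \<rho>
      using desc.prems that unfolding valid_def by simp
    ultimately show ?case
      unfolding RED.simps(2) by (subst red_gen_simp) auto
  qed
qed

lemma RED_Pair: "RED A t \<Longrightarrow> RED B s \<Longrightarrow> RED (Prod A B) (Pair t s)"
proof (induction arbitrary: s rule: RED_induct)
  case (desc t)
  note IH = desc.IH and t = desc.hyps
  from desc.prems show ?case
  proof (induction rule: RED_induct)
    case (desc s)
    have "RED (Prod A B) t'" if "dsc (Pair t s) t'" for t'
      using dsc_introD(2)[OF that] by (rule step_PairE) (use desc IH dsc_step in blast)+
    then show ?case
      using desc.hyps t unfolding RED.simps(3) by (subst red_gen_simp) auto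
  qed
qed

lemma RED_In1: "RED A t \<Longrightarrow> RED (Sum A B) (In1 t)"
proof (induction rule: RED_induct)
  case (desc t)
  have "RED (Sum A B) t'" if "dsc (In1 t) t'" for t'
    using dsc_introD(3)[OF that] by (rule step_In1E) (use desc dsc_step in blast)
  then show ?case
    using desc.hyps unfolding RED.simps(4) by (subst red_gen_simp) auto
qed

lemma RED_In2: "RED B t \<Longrightarrow> RED (Sum A B) (In2 t)"
proof (induction rule: RED_induct)
  case (desc t)
  have "RED (Sum A B) t'" if "dsc (In2 t) t'" for t'
    using dsc_introD(4)[OF that] by (rule step_In2E) (use desc dsc_step in blast)
  then show ?case
    using desc.hyps unfolding RED.simps(4) by (subst red_gen_simp) auto
qed

lemma RED_Bel_intro:
  assumes "\<And>t'. Bel ts r \<leadsto> t' \<Longrightarrow> RED (Box C) t'" "RED C r"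
  shows "RED (Box C) (Bel ts r)"
  using assms unfolding RED.simps(5) by (subst red_gen_simp) (auto dest: dsc_introD)

subsection \<open>Belief terms\<close>

definition renamed :: "tm list \<Rightarrow> tm list \<Rightarrow> bool" where
  "renamed = list_all2 (\<lambda>g g'. \<exists>\<rho>. g' = ren \<rho> g)"

text \<open>
  One entry moves to a descendant and every entry may be renamed: a permutation out of one argument
  of a \<open>Bel\<close> weakens the others.
\<close>

inductive lless :: "tm list \<Rightarrow> tm list \<Rightarrow> bool" where
  lless_hd: "dsc g g' \<Longrightarrow> renamed gs gs' \<Longrightarrow> lless (ren \<rho> g' # gs') (g # gs)"
| lless_tl: "lless gs' gs \<Longrightarrow> lless (ren \<rho> g # gs') (g # gs)"

lemma renamed_map: "renamed gs (map (ren \<rho>) gs)"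
  unfolding renamed_def by (induction gs) auto

lemma renamed_refl: "renamed gs gs"
  using renamed_map[of gs "\<lambda>i. i"] by (simp add: ren_id map_idI)

lemma renamed_trans: "renamed gs gs' \<Longrightarrow> renamed gs' gs'' \<Longrightarrow> renamed gs gs''"
  unfolding renamed_def by (rule list_all2_trans) (auto simp: ren_ren)

text \<open>A descendant of a renamed entry is a renamed descendant of the entry, so the renamings
  fold into those that \<open>lless\<close> already allows. Renaming a list thus creates no new
  predecessors, and accessibility passes to renamed lists.\<close>

lemma lless_renamed: "lless hs gs' \<Longrightarrow> renamed gs gs' \<Longrightarrow> lless hs gs"
proof (induction arbitrary: gs rule: lless.induct)
  case (lless_hd g' g0 gs' hs \<rho>)
  then obtain g \<tau> gs1 where gs: "gs = g # gs1" "g' = ren \<tau> g" "renamed gs1 gs'"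
    by (auto simp: renamed_def list_all2_Cons2)
  with lless_hd obtain g1 \<tau>' where "dsc g g1" "g0 = ren \<tau>' g1"
    using dsc_ren_inv by blast
  then show ?case
    using lless.lless_hd renamed_trans[OF gs(3) lless_hd(2)] by (simp add: gs(1) ren_ren)
next
  case (lless_tl hs gs' \<rho> g')
  then obtain g \<tau> gs1 where "gs = g # gs1" "g' = ren \<tau> g" "renamed gs1 gs'"
    by (auto simp: renamed_def list_all2_Cons2)
  with lless_tl show ?case
    using lless.lless_tl by (simp add: ren_ren)
qed

lemma accp_lless_renamed: "Wellfounded.accp lless gs \<Longrightarrow> renamed gs gs' \<Longrightarrow> Wellfounded.accp lless gs'"
  by (blast intro: accpI lless_renamed dest: accp_downward)

lemma accp_lless_Cons:
  "RED A g \<Longrightarrow> Wellfounded.accp lless gs \<Longrightarrow> Wellfounded.accp lless (g # gs)"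
proof (induction arbitrary: gs rule: RED_induct)
  case (desc g)
  note IH = desc.IH
  from desc.prems show ?case
  proof (induction rule: accp_induct_rule)
    case (1 gs)
    show ?case
    proof (rule accpI)
      fix hs assume "lless hs (g # gs)"
      then show "Wellfounded.accp lless hs"
      proof cases
        case (lless_hd g' gs' \<rho>)
        then have "Wellfounded.accp lless (g' # gs')"
          using IH accp_lless_renamed 1(1) by blast
        then show ?thesis
          by (rule accp_lless_renamed) (use lless_hd renamed_refl in \<open>auto simp: renamed_def\<close>)
      next
        case (lless_tl gs' \<rho>)
        then have "Wellfounded.accp lless (g # gs')"
          using 1(2) by blast
        then show ?thesis
          by (rule accp_lless_renamed) (use lless_tl renamed_refl in \<open>auto simp: renamed_def\<close>)
      qed
    qed
  qed
qed

lemma accp_lless: "list_all2 RED As gs \<Longrightarrow> Wellfounded.accp lless gs"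
proof (induction rule: list_all2_induct)
  case Nil
  then show ?case by (auto intro: accpI elim: lless.cases)
qed (rule accp_lless_Cons)

lemma lless_middle:
  "dsc g g' \<Longrightarrow> lless (map (ren \<rho>) as @ g' # map (ren \<rho>) bs) (as @ g # bs)"
proof (induction as)
  case Nil
  then show ?case
    using lless_hd[of g g' bs "map (ren \<rho>) bs" "\<lambda>i. i"] by (simp add: renamed_map ren_id)
qed (simp add: lless_tl)

lemma lless_update: "dsc g g' \<Longrightarrow> lless (as @ g' # bs) (as @ g # bs)"
  using lless_middle[of g g' "\<lambda>i. i" as bs] by (simp add: ren_id map_idI)

section \<open>Partially merged belief terms\<close>

text \<open>
  An argument of a \<open>Bel\<close> is either left alone or, being itself a \<open>Bel\<close>, has been merged into the
  outer one. A merged argument contributes its own arguments to the outer \<open>Bel\<close> and its body to the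
  outer body, but \<open>tot\<close> remembers the term it came from.
\<close>

datatype item = U tm | M "tm list" tm

primrec args :: "item \<Rightarrow> tm list" where
  "args (U g) = [g]"
| "args (M ss q) = ss"

text \<open>An unmerged \<open>g\<close> is treated like \<open>Bel [g] (Var 0)\<close>, the redex
  of the unit conversion. So every item \<open>x\<close> has a body under
  \<open>length (args x)\<close> binders.\<close>

primrec cont :: "item \<Rightarrow> tm" where
  "cont (U g) = Var 0"
| "cont (M ss q) = q"

primrec tot :: "item \<Rightarrow> tm" where
  "tot (U g) = g"
| "tot (M ss q) = Bel ss q"

primrec iren :: "(nat \<Rightarrow> nat) \<Rightarrow> item \<Rightarrow> item" where
  "iren \<rho> (U g) = U (ren \<rho> g)"
| "iren \<rho> (M ss q) = M (map (ren \<rho>) ss) (ren (up_ren (length ss) \<rho>) q)"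

abbreviation all_args :: "item list \<Rightarrow> tm list" where
  "all_args I \<equiv> concat (map args I)"

text \<open>Meant for a body with \<open>m\<close> binders of its own: they become the binders from
  \<open>k\<close> on of the merged term, and its free variables move beyond all \<open>n\<close>
  binders.\<close>

definition place :: "nat \<Rightarrow> nat \<Rightarrow> nat \<Rightarrow> nat \<Rightarrow> nat" where
  "place k n m i = (if i < m then k + i else n + (i - m))"

text \<open>
  The contributions of the items to the outer body: the first item starts at binder \<open>k\<close>, and the
  merged \<open>Bel\<close> has \<open>n\<close> binders.
\<close>

primrec bodies :: "nat \<Rightarrow> nat \<Rightarrow> item list \<Rightarrow> tm list" where
  "bodies k n [] = []"
| "bodies k n (x # I) =
    ren (place k n (length (args x))) (cont x)
      # bodies (k + length (args x)) n I"

text \<open>One simultaneous substitution performs all merges, a description independent of the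
  order in which they happened.\<close>

definition itbody :: "item list \<Rightarrow> tm \<Rightarrow> tm" where
  "itbody I r = sub (senv (bodies 0 (length (all_args I)) I) (\<lambda>k. k + length (all_args I))) r"

lemma length_bodies [simp]: "length (bodies k n I) = length I"
  by (induction I arbitrary: k) auto

lemma bodies_append:
  "bodies k n (I @ J) = bodies k n I @ bodies (k + length (all_args I)) n J"
  by (induction I arbitrary: k) (auto simp: add.assoc)

text \<open>A body refers only to the block of binders of its own item and to variables free
  outside. A merge in another item merely shifts both, and \<open>\<theta>\<close> may do anything
  elsewhere.\<close>

lemma bodies_sub:
  assumes "\<And>i. i < length (all_args I) \<Longrightarrow> \<theta> (k + i) = Var (k' + i)"
    and "\<And>i. \<theta> (n + i) = Var (n' + i)"
  shows "map (sub \<theta>) (bodies k n I) = bodies k' n' I"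
  using assms(1)
proof (induction I arbitrary: k k')
  case (Cons x I)
  let ?m = "length (args x)"
  have "map (sub \<theta>) (bodies (k + ?m) n I) = bodies (k' + ?m) n' I"
    using Cons.prems[of "?m + i" for i] by (intro Cons.IH) (simp add: add.assoc)
  moreover have "sub \<theta> (ren (place k n ?m) (cont x)) = ren (place k' n' ?m) (cont x)"
    unfolding sub_ren ren_eq_sub[of "place k' n' ?m"]
    by (rule sub_cong) (use Cons.prems assms(2) in \<open>auto simp: place_def simp del: Nat.add_diff_assoc\<close>)
  ultimately show ?case by simp
qed simp

lemma sub_sub_senv:
  assumes "\<And>k. \<theta> (\<rho> k) = Var (\<rho>' k)"
  shows "sub \<theta> (sub (senv bs \<rho>) r) = sub (senv (map (sub \<theta>) bs) \<rho>') r"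
  unfolding sub_sub by (rule sub_cong) (simp add: senv_def assms)

lemma cont_iren: "cont (iren \<rho> x) = ren (up_ren (length (args x)) \<rho>) (cont x)"
  by (cases x) (auto simp: up_ren_def)

lemma args_iren: "args (iren \<rho> x) = map (ren \<rho>) (args x)"
  by (cases x) auto

lemma tot_iren: "tot (iren \<rho> x) = ren \<rho> (tot x)"
  by (cases x) auto

lemma all_args_iren: "all_args (map (iren \<rho>) I) = map (ren \<rho>) (all_args I)"
  by (induction I) (auto simp: args_iren)

lemma bodies_ren:
  "k + length (all_args I) \<le> n \<Longrightarrow>
    map (ren (up_ren n \<rho>)) (bodies k n I) = bodies k n (map (iren \<rho>) I)"
  by (induction I arbitrary: k)
    (auto simp: ren_ren cont_iren args_iren up_ren_def place_def fun_eq_iff intro!: arg_cong2[where f = ren])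

lemma itbody_ren:
  "itbody (map (iren \<rho>) I) (ren (up_ren (length I) \<rho>) r) =
    ren (up_ren (length (all_args I)) \<rho>) (itbody I r)"
proof -
  let ?n = "length (all_args I)"
  have "ren (up_ren ?n \<rho>) (itbody I r) =
      sub (senv (map (ren (up_ren ?n \<rho>)) (bodies 0 ?n I)) (\<lambda>k. \<rho> k + ?n)) r"
    unfolding itbody_def ren_eq_sub[of "up_ren ?n \<rho>"]
    by (rule sub_sub_senv) (simp add: up_ren_def)
  moreover have *: "length (all_args (map (iren \<rho>) I)) = ?n"
    by (simp only: all_args_iren length_map)
  moreover have "(\<lambda>k. k + ?n) \<circ> \<rho> = (\<lambda>k. \<rho> k + ?n)"
    by auto
  ultimately show ?thesis
    unfolding itbody_def *
    by (simp add: itbody_def bodies_ren sub_senv_ren)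
qed

text \<open>Arguments enter the body only through their number, so reducing them leaves it
  fixed.\<close>

lemma itbody_cong:
  assumes "length (args x) = length (args y)" "cont x = cont y"
  shows "itbody (I @ x # J) r = itbody (I @ y # J) r"
  using assms by (simp add: itbody_def bodies_append)

text \<open>\<open>g\<close> is arbitrary: an unmerged item contributes one variable whatever its
  term is, and the merge replaces that variable by \<open>q\<close>.\<close>

lemma itbody_merge:
  "itbody (I @ M ss q # J) r =
    merge_body (length (all_args I)) (length ss) (length (all_args J)) q (itbody (I @ U g # J) r)"
proof -
  let ?p = "length (all_args I)" and ?v = "length (all_args J)" and ?m = "length ss"
  define \<theta> where "\<theta> = (\<lambda>j. if j < ?p then Var j
    else if j = ?p then ren (\<lambda>k. if k < ?m then ?p + k else ?p + ?v + k) q else Var (j + ?m - 1))"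
  have "map (sub \<theta>) (bodies 0 (?p + 1 + ?v) (I @ U g # J)) = bodies 0 (?p + ?m + ?v) (I @ M ss q # J)"
  proof -
    \<comment> \<open>Items to the left keep their binders; those to the right start at
      \<open>?p + ?m\<close> instead of \<open>?p + 1\<close>.\<close>
    have "map (sub \<theta>) (bodies 0 (?p + 1 + ?v) I) = bodies 0 (?p + ?m + ?v) I"
      by (rule bodies_sub) (auto simp: \<theta>_def)
    moreover have "map (sub \<theta>) (bodies (?p + 1) (?p + 1 + ?v) J) = bodies (?p + ?m) (?p + ?m + ?v) J"
      by (rule bodies_sub) (auto simp: \<theta>_def)
    moreover have "sub \<theta> (ren (place ?p (?p + 1 + ?v) 1) (Var 0)) = ren (place ?p (?p + ?m + ?v) ?m) q"
      by (auto simp: \<theta>_def place_def intro!: arg_cong2[where f = ren])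
    ultimately show ?thesis
      by (simp add: bodies_append)
  qed
  moreover have "sub \<theta> (sub (senv bs (\<lambda>k. k + (?p + 1 + ?v))) r) =
      sub (senv (map (sub \<theta>) bs) (\<lambda>k. k + (?p + ?m + ?v))) r" for bs
    by (rule sub_sub_senv) (simp add: \<theta>_def)
  ultimately show ?thesis
    by (simp add: itbody_def merge_body_def add.assoc flip: \<theta>_def)
qed

text \<open>Associativity of merging: a \<open>Bel\<close> exposed by an earlier merge can be merged
  into the outer term, or into its original surroundings before those are merged. The second view
  turns the step into a reduction of \<open>tot\<close>.\<close>

lemma itbody_merge_nested:
  "itbody (I @ M (s1 @ ps @ s2) (merge_body (length s1) (length ps) (length s2) t q) # J) r =
    merge_body (length (all_args I @ s1)) (length ps) (length (s2 @ all_args J)) t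
      (itbody (I @ M (s1 @ g # s2) q # J) r)"
proof -
  let ?p = "length (all_args I)" and ?v = "length (all_args J)" and ?m = "length ps"
    and ?a = "length s1" and ?b = "length s2"
  define \<theta> where "\<theta> = (\<lambda>j. if j < ?p + ?a then Var j
    else if j = ?p + ?a then ren (\<lambda>k. if k < ?m then ?p + ?a + k else ?p + ?a + (?b + ?v) + k) t
    else Var (j + ?m - 1))"
  let ?n = "?p + ?a + 1 + ?b + ?v" and ?n' = "?p + ?a + ?m + ?b + ?v"
  let ?M = "M (s1 @ ps @ s2) (merge_body ?a ?m ?b t q)"
  have "map (sub \<theta>) (bodies 0 ?n (I @ M (s1 @ g # s2) q # J)) = bodies 0 ?n' (I @ ?M # J)"
  proof -
    have "map (sub \<theta>) (bodies 0 ?n I) = bodies 0 ?n' I"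
      by (rule bodies_sub) (auto simp: \<theta>_def)
    moreover have "map (sub \<theta>) (bodies (?p + (?a + 1 + ?b)) ?n J) = bodies (?p + (?a + ?m + ?b)) ?n' J"
      by (rule bodies_sub) (auto simp: \<theta>_def)
    moreover have "sub \<theta> (ren (place ?p ?n (?a + 1 + ?b)) q) =
        ren (place ?p ?n' (?a + ?m + ?b)) (merge_body ?a ?m ?b t q)"
      unfolding merge_body_def sub_ren ren_sub
      by (rule sub_cong) (auto simp: \<theta>_def place_def ren_ren fun_eq_iff intro!: arg_cong2[where f = ren])
    ultimately show ?thesis
      by (simp add: bodies_append add.assoc)
  qed
  moreover have "sub \<theta> (sub (senv bs (\<lambda>k. k + ?n)) r) = sub (senv (map (sub \<theta>) bs) (\<lambda>k. k + ?n')) r" for bs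
    by (rule sub_sub_senv) (simp add: \<theta>_def)
  ultimately show ?thesis
    by (simp add: itbody_def merge_body_def add.assoc flip: \<theta>_def)
qed

lemma itbody_U: "itbody (map U ts) r = r"
proof -
  have "bodies k n (map U ts) = map Var [k..<k + length ts]" for k n
    by (induction ts arbitrary: k) (simp_all add: upt_conv_Cons place_def del: upt_Suc)
  then have "itbody (map U ts) r = sub Var r"
    unfolding itbody_def by (intro sub_cong) (auto simp: senv_def comp_def)
  then show ?thesis by (simp add: sub_Var)
qed

lemma RED_cont: "RED (Box A) (tot x) \<Longrightarrow> RED A (cont x)"
  by (cases x) (auto simp: RED_Var dest: RED_BelD)

lemma RED_itbody:
  assumes "list_all2 (\<lambda>A x. RED A (cont x)) As I" "valid As C r"
  shows "RED C (itbody I r)"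
proof -
  have "list_all2 RED As (bodies k n I)" for k n
    using assms(1) by (induction arbitrary: k rule: list_all2_induct) (auto intro: RED_ren)
  then show ?thesis
    using assms(2) unfolding valid_def itbody_def by blast
qed

lemma all_args_eq_appendE:
  assumes "all_args I = us @ t # vs"
  obtains I1 x I2 s1 s2 where "I = I1 @ x # I2" "args x = s1 @ t # s2"
    "us = all_args I1 @ s1" "vs = s2 @ all_args I2"
proof -
  from assms have "\<exists>I1 x I2 s1 s2. I = I1 @ x # I2 \<and> args x = s1 @ t # s2 \<and>
    us = all_args I1 @ s1 \<and> vs = s2 @ all_args I2"
  proof (induction I arbitrary: us)
    case (Cons x I)
    then have "args x @ all_args I = us @ t # vs" by simp
    then consider us' where "us = args x @ us'" "all_args I = us' @ t # vs"
      | s2 where "args x = us @ t # s2" "vs = s2 @ all_args I"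
      by (auto simp: append_eq_append_conv2 append_eq_Cons_conv Cons_eq_append_conv)
    then show ?case
    proof cases
      case 1
      from Cons.IH[OF 1(2)] obtain I1 y I2 s1 s2 where "I = I1 @ y # I2" "args y = s1 @ t # s2"
        "us' = all_args I1 @ s1" "vs = s2 @ all_args I2" by blast
      with 1 show ?thesis
        by (intro exI[of _ "x # I1"] exI[of _ y] exI[of _ I2] exI[of _ s1] exI[of _ s2]) simp
    next
      case 2
      then show ?thesis
        by (intro exI[of _ "[]"] exI[of _ x] exI[of _ I] exI[of _ us] exI[of _ s2]) simp
    qed
  qed simp
  with that show thesis by blast
qed

lemma list_all2_replace:
  assumes "list_all2 R As (I @ x # J)" "\<And>A y. R A y \<Longrightarrow> R A (f y)" "\<And>A. R A x \<Longrightarrow> R A x'"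
  shows "list_all2 R As (map f I @ x' # map f J)"
proof -
  from assms(1) obtain As1 A As2 where As: "As = As1 @ A # As2"
    "list_all2 R As1 I" "R A x" "list_all2 R As2 J"
    by (auto simp: list_all2_append2 list_all2_Cons2)
  have "list_all2 R Bs (map f K)" if "list_all2 R Bs K" for Bs K
    using that by (auto simp: list.rel_map intro: list_all2_mono assms(2))
  with As assms(3) show ?thesis
    by (simp add: list_all2_appendI)
qed

section \<open>The unit conversion on exposed arguments\<close>

lemma RED_trancl_induct [consumes 1, case_names desc]:
  assumes "RED A t" and IH: "\<And>t. RED A t \<Longrightarrow> (\<And>t'. dsc\<^sup>+\<^sup>+ t t' \<Longrightarrow> P t') \<Longrightarrow> P t"
  shows "P t"
proof -
  from assms(1) have "\<forall>t'. dsc\<^sup>*\<^sup>* t t' \<longrightarrow> P t'"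
  proof (induction rule: RED_induct)
    case (desc t)
    have *: "P t'" if "dsc\<^sup>+\<^sup>+ t t'" for t'
      using that desc.IH by (meson tranclpD)
    with IH[OF desc.hyps] show ?case
      by (metis rtranclpD)
  qed
  then show ?thesis by blast
qed

lemma RED_Box_mono: "RED (Box A) w \<Longrightarrow> (\<And>p. RED A p \<Longrightarrow> RED C p) \<Longrightarrow> RED (Box C) w"
proof (induction rule: RED_induct)
  case (desc w)
  have "RED C s" if "w = Bel ts s" for ts s
    using desc.hyps desc.prems that RED_BelD by blast
  with desc show ?case
    unfolding RED.simps(5) by (subst red_gen_simp) auto
qed

lemma merge_body_single: "merge_body 0 m 0 p q = sub (\<lambda>j. case j of 0 \<Rightarrow> p | Suc j \<Rightarrow> Var (j + m)) q"
proof -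
  have *: "(\<lambda>k. if k < m then 0 + k else 0 + 0 + k) = (\<lambda>k. k)"
    by auto
  show ?thesis
    unfolding merge_body_def * ren_id by (rule sub_cong) (simp split: nat.split)
qed

lemma merge_body_unit: "merge_body 0 m 0 p (Var 0) = p"
  by (simp add: merge_body_single)

text \<open>The binder inserted by a permutation counts as one more binder of \<open>p\<close>. This
  is why \<open>m\<close> is quantified in \<open>RED_Bel_singleD\<close>.\<close>

lemma merge_body_wk_above: "merge_body 0 m 0 p (wk_above 1 q) = merge_body 0 (Suc m) 0 p q"
  unfolding merge_body_single wk_above_def sub_ren
  by (rule sub_cong) (simp add: up_ren_def split: nat.split)

text \<open>Every descent of \<open>w\<close> is matched by descents of \<open>Bel [w] q\<close>.
  Once \<open>w\<close> is a \<open>Bel\<close> with body \<open>p\<close>, merging produces a term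
  whose body is \<open>q\<close> with \<open>p\<close> put in, and the hypothesis applies to
  it.\<close>

lemma RED_Bel_singleD:
  assumes "RED (Box A) (Bel [w] q)" and "\<And>p m. RED A (merge_body 0 m 0 p q) \<Longrightarrow> RED C p"
  shows "RED (Box C) w"
proof -
  have "\<forall>w q. g = Bel [w] q \<longrightarrow> (\<forall>p m. RED A (merge_body 0 m 0 p q) \<longrightarrow> RED C p) \<longrightarrow> RED (Box C) w"
    if "RED (Box A) g" for g
    using that
  proof (induction rule: RED_trancl_induct)
    case (desc g)
    show ?case
    proof (intro allI impI)
      fix w q assume g: "g = Bel [w] q" and q: "\<forall>p m. RED A (merge_body 0 m 0 p q) \<longrightarrow> RED C p"
      have "RED C p" if w: "w = Bel ps p" for ps p
      proof -
        have "g \<leadsto> Bel ps (merge_body 0 (length ps) 0 p q)"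
          using detour_step[OF detour_rule.intros(6)[of "[]" ps p "[]" q]] by (simp add: g w)
        with desc.hyps q show ?thesis
          using RED_step RED_BelD by blast
      qed
      moreover have "RED (Box C) w'" if "dsc w w'" for w'
        using that
      proof cases
        case 1: dsc_step
        then have "g \<leadsto> Bel [w'] q"
          using ctxt_closure.intros(14)[OF 1, of "[]" "[]" q] by (simp add: g)
        then have "dsc\<^sup>+\<^sup>+ g (Bel [w'] q)"
          by (intro tranclp.r_into_trancl dsc.intros(1))
        with desc.IH q show ?thesis
          by blast
      next
        case (dsc_branch1 a c)
        then have "g \<leadsto> Case a (Bel [w'] (wk_above 1 q)) (Bel [c] (wk_above 1 q))"
          using perm_step[OF perm_rule.intros(5)[of "[]" a w' c "[]" q]] by (simp add: g)
        \<comment> \<open>Two descents of \<open>g\<close>, a permutation and the passage to a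
          branch, match one of \<open>w\<close>; hence the induction along the transitive
          closure.\<close>
        then have "dsc\<^sup>+\<^sup>+ g (Bel [w'] (wk_above 1 q))"
          using tranclp.r_into_trancl[of dsc] tranclp.trancl_into_trancl[of dsc g] dsc.intros(1,2) by blast
        with desc.IH q merge_body_wk_above show ?thesis
          by metis
      next
        case (dsc_branch2 a b)
        then have "g \<leadsto> Case a (Bel [b] (wk_above 1 q)) (Bel [w'] (wk_above 1 q))"
          using perm_step[OF perm_rule.intros(5)[of "[]" a b w' "[]" q]] by (simp add: g)
        then have "dsc\<^sup>+\<^sup>+ g (Bel [w'] (wk_above 1 q))"
          using tranclp.r_into_trancl[of dsc] tranclp.trancl_into_trancl[of dsc g] dsc.intros(1,3) by blast
        with desc.IH q merge_body_wk_above show ?thesis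
          by metis
      qed
      ultimately show "RED (Box C) w"
        unfolding RED.simps(5) by (subst red_gen_simp) auto
    qed
  qed
  with assms show ?thesis by blast
qed

lemma steps_sub: "step\<^sup>*\<^sup>* t t' \<Longrightarrow> step\<^sup>*\<^sup>* (sub \<sigma> t) (sub \<sigma> t')"
  by (rule steps_map) (rule step_sub)

lemma steps_merge_body: "step\<^sup>*\<^sup>* b b' \<Longrightarrow> step\<^sup>*\<^sup>* (merge_body p m q t b) (merge_body p m q t b')"
  unfolding merge_body_def by (rule steps_sub)

lemma steps_wk_above: "step\<^sup>*\<^sup>* b b' \<Longrightarrow> step\<^sup>*\<^sup>* (wk_above k b) (wk_above k b')"
  unfolding wk_above_def ren_eq_sub by (rule steps_sub)

section \<open>Reducibility of belief terms\<close>

primrec is_U :: "item \<Rightarrow> bool" where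
  "is_U (U g) = True"
| "is_U (M ss q) = False"

definition reducible_items :: "ty list \<Rightarrow> item list \<Rightarrow> bool" where
  "reducible_items As I \<longleftrightarrow> list_all2 (\<lambda>A x. RED (Box A) (tot x)) As I"

text \<open>The first two facts serve reductions in place; the last two serve permutations, which
  put the other items under a binder.\<close>

lemma reducible_items_replace:
  assumes "reducible_items As (I @ x # J)" "dsc (tot x) (tot x')"
  shows "reducible_items As (I @ x' # J)" "lless (map tot (I @ x' # J)) (map tot (I @ x # J))"
    "reducible_items As (map (iren \<rho>) I @ x' # map (iren \<rho>) J)"
    "lless (map tot (map (iren \<rho>) I @ x' # map (iren \<rho>) J)) (map tot (I @ x # J))"
proof -
  show "reducible_items As (I @ x' # J)"
    using list_all2_replace[of _ As I x J "\<lambda>x. x" x'] assms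
    unfolding reducible_items_def by (auto intro: RED_dsc)
  show "reducible_items As (map (iren \<rho>) I @ x' # map (iren \<rho>) J)"
    using assms unfolding reducible_items_def
    by (intro list_all2_replace[of _ As I x J]) (auto simp: tot_iren intro: RED_dsc RED_ren)
  show "lless (map tot (I @ x' # J)) (map tot (I @ x # J))"
    using lless_update[OF assms(2)] by simp
  have "map tot (map (iren \<rho>) K) = map (ren \<rho>) (map tot K)" for K
    by (simp add: tot_iren)
  then show "lless (map tot (map (iren \<rho>) I @ x' # map (iren \<rho>) J)) (map tot (I @ x # J))"
    using lless_middle[OF assms(2), of \<rho> "map tot I" "map tot J"] by (simp only: map_append list.map)
qed

lemma itbody_wk:
  "itbody (map (iren Suc) I @ U b # map (iren Suc) J) (wk_above (length I + 1 + length J) r) =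
    wk_above (length (all_args I) + 1 + length (all_args J)) (itbody (I @ U g # J) r)"
proof -
  have "itbody (map (iren Suc) I @ U b # map (iren Suc) J) r' =
      itbody (map (iren Suc) (I @ U g # J)) r'" for r'
    using itbody_cong[of "U b" "U (ren Suc g)"] by simp
  then show ?thesis
    using itbody_ren[of Suc "I @ U g # J" r] unfolding wk_above_def by simp
qed

lemma map_wk_all_args: "map (wk 1) (all_args I) = all_args (map (iren Suc) I)"
  unfolding all_args_iren wk_1[abs_def] ..

lemma RED_Bel_items_unit:
  assumes I: "reducible_items As I" and r: "valid As C r"
    and b: "step\<^sup>*\<^sup>* (itbody I r) (Var 0)" and w: "all_args I = [w]"
  shows "RED (Box C) w"
proof -
  from w have "all_args I = [] @ w # []" by simp
  then obtain I1 x I2 where x: "I = I1 @ x # I2" "args x = [w]"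
    "all_args I1 = []" "all_args I2 = []"
    by (elim all_args_eq_appendE) auto
  from I x(1) obtain As1 A As2 where As: "As = As1 @ A # As2" "RED (Box A) (tot x)"
    "list_all2 (\<lambda>A x. RED (Box A) (tot x)) As1 I1" "list_all2 (\<lambda>A x. RED (Box A) (tot x)) As2 I2"
    by (auto simp: reducible_items_def list_all2_append2 list_all2_Cons2)
  have *: "RED C (itbody (I1 @ y # I2) r)" if "RED A (cont y)" for y
  proof (rule RED_itbody[OF _ r])
    have "list_all2 (\<lambda>A x. RED A (cont x)) Bs K" if "list_all2 (\<lambda>A x. RED (Box A) (tot x)) Bs K" for Bs K
      using that by (rule list_all2_mono) (rule RED_cont)
    with As that show "list_all2 (\<lambda>A x. RED A (cont x)) As (I1 @ y # I2)"
      by (simp add: list_all2_appendI)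
  qed
  show ?thesis
  proof (cases x)
    case (U g)
    \<comment> \<open>An arbitrary reducible \<open>p\<close> takes the place of the item. Since the
      body reduces to the bare variable, its instance reduces to \<open>p\<close>; so reducibility
      at \<open>A\<close> entails reducibility at \<open>C\<close>.\<close>
    have "RED C p" if "RED A p" for p
    proof (rule RED_steps)
      show "RED C (itbody (I1 @ M [] p # I2) r)"
        using that by (intro *) simp
      show "step\<^sup>*\<^sup>* (itbody (I1 @ M [] p # I2) r) p"
        using steps_merge_body[OF b, of 0 0 0 p]
        unfolding x(1) U itbody_merge[of I1 "[]" p I2 r g] x(3,4) by (simp add: merge_body_unit)
    qed
    with As(2) U x(2) show ?thesis
      by (auto intro: RED_Box_mono)
  next
    case (M ss q)
    have "RED C p" if "RED A (merge_body 0 m 0 p q)" for p m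
    proof (rule RED_steps)
      \<comment> \<open>Dummy arguments for the \<open>m\<close> binders of \<open>p\<close>: only
        their number enters the body.\<close>
      let ?ps = "replicate m (Var 0)"
      let ?y = "M ([] @ ?ps @ []) (merge_body (length ([] :: tm list)) (length ?ps) (length ([] :: tm list)) p q)"
      show "RED C (itbody (I1 @ ?y # I2) r)"
        using that by (intro *) simp
      show "step\<^sup>*\<^sup>* (itbody (I1 @ ?y # I2) r) p"
        using steps_merge_body[OF b, of 0 m 0 p] x(2)
        unfolding x(1) M itbody_merge_nested[of I1 "[]" ?ps "[]" p q I2 r w] x(3,4) by (simp add: merge_body_unit)
    qed
    with As(2) M x(2) show ?thesis
      by (auto intro: RED_Bel_singleD)
  qed
qed

lemma RED_Bel_items_perm:
  assumes IH: "\<And>g'. Case d c1 c2 \<leadsto> g' \<Longrightarrow> RED T (Bel (us @ g' # vs) b)"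
    and branches:
      "\<And>c. c = c1 \<or> c = c2 \<Longrightarrow> RED T (Bel (map (wk 1) us @ c # map (wk 1) vs) (wk_above n b))"
    and n: "n = length us + 1 + length vs"
  shows "RED T (Case d (Bel (map (wk 1) us @ c1 # map (wk 1) vs) (wk_above n b))
    (Bel (map (wk 1) us @ c2 # map (wk 1) vs) (wk_above n b)))"
proof (rule RED_perm_frame[where F = "\<lambda>g. Bel (us @ g # vs) b"
      and F' = "\<lambda>g. Bel (map (wk 1) us @ g # map (wk 1) vs) (wk_above n b)"])
  show "Bel (us @ Case d c1 c2 # vs) b \<leadsto> Case d
    (Bel (map (wk 1) us @ c1 # map (wk 1) vs) (wk_above n b))
    (Bel (map (wk 1) us @ c2 # map (wk 1) vs) (wk_above n b))" for d c1 c2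
    unfolding n by (rule perm_step) (rule perm_rule.intros)
  show "subst0 p (Bel (map (wk 1) us @ c # map (wk 1) vs) (wk_above n b)) = Bel (us @ subst0 p c # vs) b" for p c
    using n by (rule subst0_Bel_wk)
  have *: "wk_above 1 (Bel (map (wk 1) us @ c # map (wk 1) vs) (wk_above n b)) =
    Bel (map (wk 1) (map (wk 1) us) @ wk_above 1 c # map (wk 1) (map (wk 1) vs))
      (wk_above n (wk_above n b))" for c
  proof -
    have "length (map (wk 1) us @ c # map (wk 1) vs) = n"
      by (simp add: n)
    moreover have "map (ren (up_ren 1 Suc)) (map (wk 1) ts) = map (wk 1) (map (wk 1) ts)" for ts
      using wk_above_wk unfolding wk_above_def by simp
    ultimately show ?thesis
      unfolding wk_above_def[of 1] ren.simps by (simp only: ren_wk_above_wk_above map_append list.map)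
  qed
  show "Bel (map (wk 1) us @ Case d (wk_above 1 c1) (wk_above 1 c2) # map (wk 1) vs) (wk_above n b) \<leadsto>
    Case d (wk_above 1 (Bel (map (wk 1) us @ c1 # map (wk 1) vs) (wk_above n b)))
      (wk_above 1 (Bel (map (wk 1) us @ c2 # map (wk 1) vs) (wk_above n b)))" for d c1 c2
    unfolding * using perm_step[OF perm_rule.intros(5)[of "map (wk 1) us" d "wk_above 1 c1" "wk_above 1 c2"
          "map (wk 1) vs" "wk_above n b"]]
    unfolding length_map n .
qed (use IH branches in blast)+

text \<open>
  A permutation out of an argument of a merged item is reached by performing it in the unmerged item
  first and merging both branches afterwards.
\<close>

lemma steps_Bel_unmerge:
  fixes s1 s2 :: "tm list" and q :: tm
  defines "P \<equiv> \<lambda>c. Bel (map (wk 1) s1 @ c # map (wk 1) s2) (wk_above (length s1 + 1 + length s2) q)"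
  assumes n: "n = length us + (length s1 + 1 + length s2) + length vs"
  shows "step\<^sup>*\<^sup>* (Bel (us @ Case d (P c1) (P c2) # vs) b) (Case d
    (Bel (map (wk 1) us @ (map (wk 1) s1 @ c1 # map (wk 1) s2) @ map (wk 1) vs)
      (wk_above n (merge_body (length us) (length s1 + 1 + length s2) (length vs) q b)))
    (Bel (map (wk 1) us @ (map (wk 1) s1 @ c2 # map (wk 1) s2) @ map (wk 1) vs)
      (wk_above n (merge_body (length us) (length s1 + 1 + length s2) (length vs) q b))))"
    (is "step\<^sup>*\<^sup>* _ (Case d (?Q c1) (?Q c2))")
proof -
  let ?R = "\<lambda>c. Bel (map (wk 1) us @ P c # map (wk 1) vs) (wk_above (length us + 1 + length vs) b)"
  have "?R c \<leadsto> ?Q c" for c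
  proof -
    have "wk_above n (merge_body (length us) (length s1 + 1 + length s2) (length vs) q b) =
      merge_body (length us) (length s1 + 1 + length s2) (length vs)
        (wk_above (length s1 + 1 + length s2) q) (wk_above (length us + 1 + length vs) b)"
      unfolding wk_above_def n ren_merge_body ..
    moreover have "length (map (wk 1) s1 @ c # map (wk 1) s2) = length s1 + 1 + length s2"
      by simp
    ultimately show ?thesis
      unfolding P_def using detour_step[OF detour_rule.intros(6)[of "map (wk 1) us"
          "map (wk 1) s1 @ c # map (wk 1) s2" "wk_above (length s1 + 1 + length s2) q"
          "map (wk 1) vs" "wk_above (length us + 1 + length vs) b"]]
      by (simp only: length_map)
  qed
  then have "step\<^sup>*\<^sup>* (Case d (?R c1) (?R c2)) (Case d (?Q c1) (?Q c2))"
    by (intro steps_Case r_into_rtranclp)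
  moreover have "Bel (us @ Case d (P c1) (P c2) # vs) b \<leadsto> Case d (?R c1) (?R c2)"
    by (rule perm_step) (rule perm_rule.intros)
  ultimately show ?thesis
    by (rule converse_rtranclp_into_rtranclp[rotated])
qed

text \<open>Three nested inductions: on \<open>map tot I\<close> along \<open>lless\<close>; on the
  number of unmerged items, which merging an original argument lowers without changing
  \<open>map tot I\<close>; and on the reducible body \<open>b\<close>. The body is any reduct of
  \<open>itbody I r\<close>, since its reductions need not come from \<open>r\<close> or from an
  item. \<open>r\<close> itself is kept, up to weakening, so that validity still applies after an
  item has changed.\<close>

lemma RED_Bel_items:
  assumes "reducible_items As I" "valid As C r" "step\<^sup>*\<^sup>* (itbody I r) b"
  shows "RED (Box C) (Bel (all_args I) b)"
proof -
  define gs where "gs = map tot I"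
  have "list_all2 RED (map Box As) gs"
    using assms(1) by (simp add: gs_def reducible_items_def list.rel_map)
  then have "Wellfounded.accp lless gs"
    by (rule accp_lless)
  then show ?thesis
    using gs_def assms
  proof (induction gs arbitrary: I r b rule: accp_induct_rule)
    case (1 gs)
    have IH_tot: "RED (Box C) (Bel (all_args I') b')"
      if "lless (map tot I') gs" "reducible_items As I'" "valid As C r'" "step\<^sup>*\<^sup>* (itbody I' r') b'"
      for I' r' b'
      using 1(2)[OF that(1) refl that(2-)] .
    from 1(3-) show ?case
    proof (induction "length (filter is_U I)" arbitrary: I b rule: less_induct)
      case (less I b)
      note IH_merge = less(1) and tot_I = less(2) and I = less(3) and r = less(4)
      have "list_all2 (\<lambda>A x. RED A (cont x)) As I"
        using I unfolding reducible_items_def by (rule list_all2_mono) (rule RED_cont)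
      then have "RED C b"
        using RED_itbody r less(5) RED_steps by blast
      then show ?case
        using less(5)
      proof (induction rule: RED_induct)
        case (desc b)
        note b = desc.prems
        have IH_body: "RED (Box C) (Bel (all_args I) b')" if "b \<leadsto> b'" for b'
          using desc.IH[OF dsc_step[OF that]] rtranclp.rtrancl_into_rtrancl[OF b that] .
        show ?case
        proof (rule RED_Bel_intro)
          fix t' assume "Bel (all_args I) b \<leadsto> t'"
          then show "RED (Box C) t'"
          proof (cases rule: step_BelE)
            case (arg us t u vs)
            from arg(1) obtain I1 x I2 s1 s2 where x: "I = I1 @ x # I2" "args x = s1 @ t # s2"
              and uv: "us = all_args I1 @ s1" "vs = s2 @ all_args I2"
              by (rule all_args_eq_appendE)
            \<comment> \<open>The reduction takes place inside the original term of the item and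
              leaves its contribution to the body alone.\<close>
            obtain y where y: "args y = s1 @ u # s2" "cont y = cont x" "dsc (tot x) (tot y)"
            proof (cases x)
              case (U g)
              with x arg(2) show thesis
                by (intro that[of "U u"]) (auto simp: append_eq_Cons_conv Cons_eq_append_conv intro: dsc_step)
            next
              case (M ss q)
              with x arg(2) show thesis
                by (intro that[of "M (s1 @ u # s2) q"]) (auto intro: dsc_step ctxt_closure.intros(14))
            qed
            note y_I = reducible_items_replace[OF I[unfolded x(1)] y(3), folded x(1), folded tot_I]
            have "itbody (I1 @ y # I2) r = itbody I r"
              unfolding x(1) by (rule itbody_cong) (simp_all add: x(2) y)
            then have "RED (Box C) (Bel (all_args (I1 @ y # I2)) b)"
              using b by (intro IH_tot[OF y_I(2,1) r]) simp
            then show ?thesis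
              by (simp add: arg(3) uv y(1))
          next
            case (body b')
            then show ?thesis
              using IH_body by simp
          next
            case (merge us ss t vs)
            from merge(1) obtain I1 x I2 s1 s2 where x: "I = I1 @ x # I2" "args x = s1 @ Bel ss t # s2"
              and uv: "us = all_args I1 @ s1" "vs = s2 @ all_args I2"
              by (rule all_args_eq_appendE)
            show ?thesis
            proof (cases x)
              case (U g)
              then have g: "s1 = []" "s2 = []" "x = U (Bel ss t)"
                using x(2) by (auto simp: append_eq_Cons_conv Cons_eq_append_conv)
              \<comment> \<open>The item changes from \<open>U\<close> to \<open>M\<close> with the
                same \<open>tot\<close>, so it is the second measure that drops.\<close>
              have "RED (Box C) (Bel (all_args (I1 @ M ss t # I2))
                (merge_body (length (all_args I1)) (length ss) (length (all_args I2)) t b))"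
              proof (rule IH_merge)
                show "length (filter is_U (I1 @ M ss t # I2)) < length (filter is_U I)"
                  by (simp add: x(1) g(3))
                show "gs = map tot (I1 @ M ss t # I2)"
                  by (simp add: tot_I x(1) g(3))
                show "reducible_items As (I1 @ M ss t # I2)"
                  using I by (simp add: reducible_items_def x(1) g(3) list_all2_append2 list_all2_Cons2)
                show "step\<^sup>*\<^sup>* (itbody (I1 @ M ss t # I2) r)
                  (merge_body (length (all_args I1)) (length ss) (length (all_args I2)) t b)"
                  unfolding itbody_merge[of I1 ss t I2 r "Bel ss t"]
                  by (rule steps_merge_body) (use b x(1) g(3) in simp)
              qed (fact r)
              then show ?thesis
                by (simp add: merge(2) uv g)
            next
              case (M ss' q)
              \<comment> \<open>The merge is performed inside the original term, so the first
                measure drops.\<close>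
              define y where
                "y = M (s1 @ ss @ s2) (merge_body (length s1) (length ss) (length s2) t q)"
              have "tot x \<leadsto> tot y"
                using M x(2) unfolding y_def by (auto intro: detour_step detour_rule.intros)
              note y_I = reducible_items_replace[OF I[unfolded x(1)] dsc_step[OF this], folded x(1), folded tot_I]
              have "RED (Box C) (Bel (all_args (I1 @ y # I2))
                (merge_body (length (all_args I1 @ s1)) (length ss) (length (s2 @ all_args I2)) t b))"
              proof (rule IH_tot[OF y_I(2,1) r])
                show "step\<^sup>*\<^sup>* (itbody (I1 @ y # I2) r)
                  (merge_body (length (all_args I1 @ s1)) (length ss) (length (s2 @ all_args I2)) t b)"
                  unfolding y_def itbody_merge_nested[of I1 s1 ss s2 t q I2 r "Bel ss t"]
                  by (rule steps_merge_body) (use b x M in simp)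
              qed
              then show ?thesis
                by (simp add: merge(2) uv y_def)
            qed
          next
            case unit
            then show ?thesis
              using RED_Bel_items_unit[OF I r] b by simp
          next
            case (perm us d c1 c2 vs)
            from perm(1) obtain I1 x I2 s1 s2 where x: "I = I1 @ x # I2" "args x = s1 @ Case d c1 c2 # s2"
              and uv: "us = all_args I1 @ s1" "vs = s2 @ all_args I2"
              by (rule all_args_eq_appendE)
            show ?thesis
            proof (cases x)
              case (U g)
              then have g: "s1 = []" "s2 = []" "x = U (Case d c1 c2)"
                using x(2) by (auto simp: append_eq_Cons_conv Cons_eq_append_conv)
              then have us: "us = all_args I1" "vs = all_args I2"
                by (simp_all add: uv)
              show ?thesis
                unfolding perm(2)
              proof (rule RED_Bel_items_perm)
                fix g' assume "Case d c1 c2 \<leadsto> g'"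
                then have "dsc (tot x) (tot (U g'))"
                  by (simp add: g(3) dsc_step)
                note y_I = reducible_items_replace[OF I[unfolded x(1)] this, folded x(1), folded tot_I]
                have "itbody (I1 @ U g' # I2) r = itbody I r"
                  unfolding x(1) g(3) by (rule itbody_cong) simp_all
                then have "RED (Box C) (Bel (all_args (I1 @ U g' # I2)) b)"
                  using b by (intro IH_tot[OF y_I(2,1) r]) simp
                then show "RED (Box C) (Bel (us @ g' # vs) b)"
                  by (simp add: us)
              next
                \<comment> \<open>A branch is a descendant of the original argument, and
                  \<open>lless\<close> permits the weakening of the other items.\<close>
                fix c assume "c = c1 \<or> c = c2"
                then have "dsc (tot x) (tot (U c))"
                  by (auto simp: g(3) intro: dsc.intros)
                note y_I = reducible_items_replace[OF I[unfolded x(1)] this, folded x(1), folded tot_I]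
                let ?I = "map (iren Suc) I1 @ U c # map (iren Suc) I2"
                have "length As = length I1 + 1 + length I2"
                  using I list_all2_lengthD by (fastforce simp: reducible_items_def x(1))
                then have "valid As C (wk_above (length I1 + 1 + length I2) r)"
                  unfolding wk_above_def using valid_ren[OF r, of Suc] by simp
                moreover have "step\<^sup>*\<^sup>* (itbody ?I (wk_above (length I1 + 1 + length I2) r))
                  (wk_above (length us + 1 + length vs) b)"
                  unfolding itbody_wk[of I1 c I2 r "Case d c1 c2"] us
                  by (rule steps_wk_above) (use b x(1) g(3) in simp)
                ultimately have "RED (Box C) (Bel (all_args ?I) (wk_above (length us + 1 + length vs) b))"
                  using IH_tot[OF y_I(4,3)] by blast
                then show "RED (Box C) (Bel (map (wk 1) us @ c # map (wk 1) vs)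
                  (wk_above (length us + 1 + length vs) b))"
                  unfolding us map_wk_all_args by simp
              qed simp
            next
              case (M ss q)
              define P where
                "P = (\<lambda>c. Bel (map (wk 1) s1 @ c # map (wk 1) s2) (wk_above (length s1 + 1 + length s2) q))"
              \<comment> \<open>Making the item unmerged again raises the second measure, but its
                term is a reduct of \<open>tot x\<close>, so the first one has dropped.\<close>
              define y where "y = U (Case d (P c1) (P c2))"
              have "tot x \<leadsto> tot y"
                using M x(2) unfolding y_def P_def
                by (simp add: perm_step perm_rule.intros(5) del: One_nat_def)
              note y_I = reducible_items_replace[OF I[unfolded x(1)] dsc_step[OF this], folded x(1), folded tot_I]
              let ?B = "merge_body (length (all_args I1)) (length s1 + 1 + length s2) (length (all_args I2)) q
                (itbody (I1 @ y # I2) r)"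
              have "?B = itbody I r"
                using itbody_merge[of I1 ss q I2 r "Case d (P c1) (P c2)"] M x(2)
                by (simp add: x(1) y_def)
              have n: "length us + 1 + length vs =
                  length (all_args I1) + (length s1 + 1 + length s2) + length (all_args I2)"
                by (simp add: uv)
              \<comment> \<open>The unreduced body is the starting point, because \<open>b\<close>
                need not come from a reduct of the unmerged one. Once both branches are merged
                again, their bodies reduce to weakenings of \<open>b\<close>.\<close>
              have "RED (Box C) (Bel (all_args (I1 @ y # I2)) (itbody (I1 @ y # I2) r))"
                by (rule IH_tot[OF y_I(2,1) r]) simp
              then have "RED (Box C) (Bel (all_args I1 @ Case d (P c1) (P c2) # all_args I2)
                  (itbody (I1 @ y # I2) r))"
                by (simp add: y_def)
              from RED_steps[OF steps_Bel_unmerge[OF n, where q = q] this[unfolded P_def]]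
              have *: "RED (Box C) (Case d
                (Bel (map (wk 1) us @ c1 # map (wk 1) vs) (wk_above (length us + 1 + length vs) (itbody I r)))
                (Bel (map (wk 1) us @ c2 # map (wk 1) vs) (wk_above (length us + 1 + length vs) (itbody I r))))"
                unfolding \<open>?B = itbody I r\<close> by (simp add: uv)
              have "step\<^sup>*\<^sup>* (Bel ts (wk_above k (itbody I r))) (Bel ts (wk_above k b))" for ts k
                by (rule steps_map[OF _ steps_wk_above[OF b]]) (rule ctxt_closure.intros(15))
              then show ?thesis
                unfolding perm(2) by (intro RED_steps[OF steps_Case *])
            qed
          qed
        qed (fact desc.hyps)
      qed
    qed
  qed
qed

lemma RED_Bel:
  assumes "list_all2 (\<lambda>t A. RED (Box A) t) ts As" "valid As C r"
  shows "RED (Box C) (Bel ts r)"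
proof -
  have "reducible_items As (map U ts)"
    using assms(1) by (auto simp: reducible_items_def list_all2_conv_all_nth)
  moreover have "all_args (map U ts) = ts"
    by (induction ts) simp_all
  ultimately show ?thesis
    using RED_Bel_items[OF _ assms(2), of "map U ts" r] by (simp add: itbody_U)
qed

section \<open>Reducible instances of typed terms, and strong normalization\<close>

lemma RED_sub_senv:
  assumes "\<And>\<sigma>. (\<And>i. i < length (As @ \<Gamma>) \<Longrightarrow> RED ((As @ \<Gamma>) ! i) (\<sigma> i)) \<Longrightarrow> RED C (sub \<sigma> t)"
    and "\<And>i. i < length \<Gamma> \<Longrightarrow> RED (\<Gamma> ! i) (\<sigma> i)"
  shows "valid As C (sub (up_sub (length As) \<sigma>) t)"
  unfolding valid_def
proof (intro allI impI)
  fix bs \<rho> assume bs: "list_all2 RED As bs"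
  show "RED C (sub (senv bs \<rho>) (sub (up_sub (length As) \<sigma>) t))"
    unfolding sub_senv_up_sub[OF list_all2_lengthD[OF bs, symmetric]]
    using bs assms(2) by (intro assms(1)) (auto simp: nth_append list_all2_conv_all_nth RED_ren)
qed

lemma RED_sub:
  assumes "typed \<Gamma> t A" "\<And>i. i < length \<Gamma> \<Longrightarrow> RED (\<Gamma> ! i) (\<sigma> i)"
  shows "RED A (sub \<sigma> t)"
  using assms
proof (induction arbitrary: \<sigma> rule: typed.induct)
  case (ty_Lam A \<Gamma> t B)
  have "valid [A] B (sub (up_sub (length [A]) \<sigma>) t)"
    by (rule RED_sub_senv) (use ty_Lam in auto)
  then show ?case
    by (simp add: RED_Lam)
next
  case (ty_Case \<Gamma> t A B t1 C t2)
  have "valid [A] C (sub (up_sub (length [A]) \<sigma>) t1)"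
    by (rule RED_sub_senv) (use ty_Case in auto)
  moreover have "valid [B] C (sub (up_sub (length [B]) \<sigma>) t2)"
    by (rule RED_sub_senv) (use ty_Case in auto)
  moreover have "RED (Sum A B) (sub \<sigma> t)"
    using ty_Case by blast
  ultimately show ?case
    using RED_Case by simp
next
  case (ty_Bel \<Gamma> ts As s B)
  have "valid As B (sub (up_sub (length As) \<sigma>) s)"
    by (rule RED_sub_senv) (use ty_Bel in auto)
  moreover have "list_all2 (\<lambda>t A. RED (Box A) t) (map (sub \<sigma>) ts) As"
    using ty_Bel by (auto simp: list.rel_map elim: list_all2_mono)
  moreover have "length ts = length As"
    using ty_Bel(1) by (rule list_all2_lengthD)
  ultimately show ?case
    by (simp add: RED_Bel)
qed (auto intro: RED_App RED_Pair RED_Pr1 RED_Pr2 RED_In1 RED_In2)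

lemma strongly_normalizing_RED:
  assumes "RED A t"
  shows "strongly_normalizing step t"
proof -
  from assms have "f 0 = t \<Longrightarrow> \<exists>i. \<not> f i \<leadsto> f (Suc i)" for f :: "nat \<Rightarrow> tm"
  proof (induction arbitrary: f rule: RED_induct)
    case (desc t)
    show ?case
    proof (cases "f 0 \<leadsto> f 1")
      case True
      then have "dsc t (f 1)"
        unfolding desc.prems by (rule dsc_step)
      from desc.IH[OF this, of "\<lambda>i. f (Suc i)"] show ?thesis
        by auto
    next
      case False
      then show ?thesis
        by (intro exI[of _ 0]) simp
    qed
  qed
  then show ?thesis
    unfolding strongly_normalizing_def by blast
qed

lemma ctxt_closure_mono: "ctxt_closure R t u \<Longrightarrow> (\<And>t u. R t u \<Longrightarrow> S t u) \<Longrightarrow> ctxt_closure S t u"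
proof (induction rule: ctxt_closure.induct)
  case (1 t u)
  then show ?case
    using ctxt_closure.intros(1)[of S] by simp
qed (rule ctxt_closure.intros(2-), simp)+

theorem theorem20:
  fixes \<Gamma> :: "ty list" and t :: tm and A :: ty
  assumes "typed \<Gamma> t A"
  shows "strongly_normalizing (\<lambda>u v. detour u v \<or> permutation u v) t"
proof -
  have "RED A (sub Var t)"
    using assms by (rule RED_sub) (rule RED_Var)
  then have "strongly_normalizing step t"
    unfolding sub_Var by (rule strongly_normalizing_RED)
  moreover have "u \<leadsto> v" if "detour u v \<or> permutation u v" for u v
    using that unfolding detour_def permutation_def by (auto elim: ctxt_closure_mono)
  ultimately show ?thesis
    unfolding strongly_normalizing_def by blast
qed

end
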